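(* Let $\lambda>0$, $\sigma>0$, $h>0$, and let $\alpha_1\neq\alpha_2$ be real numbers. Let $\varepsilon=(\varepsilon_t)_{t\ge 0}$ be a continuous-time Markov chain on $\{1,2\}$ with intensity matrix $Q=\begin{pmatrix}-\lambda&\lambda\\ \lambda&-\lambda\end{pmatrix}$, let $W$ be a standard Brownian motion independent of $\varepsilon$, and let $Z_h=\int_0^h\alpha_{\varepsilon_s}\,ds+\sigma W_h$. Put $a=\frac12(\alpha_1+\alpha_2)$, $b_1=\frac12(\alpha_1-\alpha_2)$, $b_2=\frac12(\alpha_2-\alpha_1)$. Then the following hold. (i) For $i=1,2$, the density of $Z_h$ given $\varepsilon_0=i$ is $$g_i(z,h)=e^{-\lambda h}\Big[\phi_{\sigma\sqrt h}(z-h(b_i+a))+\frac1{|b_i|}\int_{h(a-|b_i|)}^{h(a+|b_i|)}\phi_{\sigma\sqrt h}(z-x)\,\tilde q_{h,\lambda}\Big(\frac{x-ah}{b_i}\Big)dx\Big],\quad z\in\mathbb{R},$$ with $$\tilde q_{h,\lambda}(x)=\frac\lambda2\Big[B_0\big(\lambda\sqrt{h^2-x^2}\big)+\Big(\frac{h+x}{h-x}\Big)^{1/2}B_1\big(\lambda\sqrt{h^2-x^2}\big)\Big],\quad x\in[-h,h].$$ (ii) For $i=1,2$, the density of $Z_h$ given $\varepsilon_0=\varepsilon_h=i$ is $$g_{ii}(z,h)=\frac1{\cosh(\lambda h)}\Big[\phi_{\sigma\sqrt h}(z-h(b_i+a))+\frac1{|b_i|}\int_{h(a-|b_i|)}^{h(a+|b_i|)}\phi_{\sigma\sqrt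 h}(z-x)\,\tilde q_{h,+}\Big(\frac{x-ah}{b_i}\Big)dx\Big],\quad z\in\mathbb{R},$$ with $$\tilde q_{h,+}(x)=\frac\lambda2\Big(\frac{h+x}{h-x}\Big)^{1/2}B_1\big(\lambda\sqrt{h^2-x^2}\big),\quad x\in[-h,h].$$ (iii) For $i,j\in\{1,2\}$ with $i\ne j$, the density of $Z_h$ given $\varepsilon_0=i$, $\varepsilon_h=j$ is $$g_{ij}(z,h)=\frac1{\sinh(\lambda h)\,|b_i|}\int_{h(a-|b_i|)}^{h(a+|b_i|)}\phi_{\sigma\sqrt h}(z-x)\,\tilde q_{h,-}\Big(\frac{x-ah}{b_i}\Big)dx,\quad z\in\mathbb{R},$$ with $$\tilde q_{h,-}(x)=\frac\lambda2B_0\big(\lambda\sqrt{h^2-x^2}\big),\quad x\in[-h,h].$$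
   Context: The functions $B_0,B_1$ are the modified Bessel functions $$B_0(z)=\sum_{k=0}^\infty\frac{(z^2/4)^k}{(k!)^2},\qquad B_1(z)=\frac z2\sum_{k=0}^\infty\frac{(z^2/4)^k}{k!\,(k+1)!},\qquad z\ge0.$$ For $s>0$, $\phi_s(x)=\frac1{\sqrt{2\pi}\,s}e^{-x^2/(2s^2)}$, $x\in\mathbb{R}$, is the density of the centred normal distribution with standard deviation $s$. The intensity matrix convention is that the transition probabilities are $\mathbb{P}(\varepsilon_{t+h}=j\mid\varepsilon_t=i)=(e^{Qh})_{i,j}$. Conditioning on $\varepsilon_0=i$ means working under the law of $(\varepsilon,W)$ with the chain started in state $i$. Densities are with respect to Lebesgue measure: $g_i(z,h)=\mathbb{P}(Z_h\in dz\mid\varepsilon_0=i)/dz$ and $g_{ij}(z,h)=\mathbb{P}(Z_h\in dz\mid\varepsilon_0=i,\varepsilon_h=j)/dz$. The functions $\tilde q$ enter only under integrals, so their values at the endpoints $x=\pm h$ are immaterial. *)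

theory Defs
  imports "HOL-Probability.Probability"
begin

section \<open>Markov chains with a given intensity matrix\<close>

text \<open>The multiplication of the type of square matrices is componentwise, so the
  library constant \<^const>\<open>exp\<close> is not the matrix exponential.\<close>

definition matrix_exp :: "real^'n^'n \<Rightarrow> real^'n^'n" where
  "matrix_exp A = (\<Sum>k. (1 / fact k) *\<^sub>R (((**) A ^^ k) (mat 1)))"

text \<open>The finite state space carries the discrete topology, in which right-continuity at
  \<open>t\<close> says that the path is constant on some interval \<open>[t, t + \<delta>)\<close>. The initial
  distribution is arbitrary. Processes are indexed by \<^typ>\<open>real\<close>, and only times
  \<open>t \<ge> 0\<close> matter.\<close>

definition markov_chain ::
  "'a measure \<Rightarrow> real^'s^'s \<Rightarrow> (real \<Rightarrow> 'a \<Rightarrow> 's::finite) \<Rightarrow> bool" where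
  "markov_chain M Q X \<longleftrightarrow>
     (\<forall>t\<ge>0. X t \<in> measurable M (count_space UNIV)) \<and>
     (\<forall>\<omega>\<in>space M. \<forall>t\<ge>0. \<forall>\<^sub>F s in at_right t. X s \<omega> = X t \<omega>) \<and>
     (\<forall>(n::nat) (t :: nat \<Rightarrow> real) (x :: nat \<Rightarrow> 's) u j.
        0 \<le> t 0 \<longrightarrow> (\<forall>k<n. t k < t (Suc k)) \<longrightarrow> 0 \<le> u \<longrightarrow>
        \<P>(\<omega> in M. \<forall>k\<le>n. X (t k) \<omega> = x k) > 0 \<longrightarrow>
        \<P>(\<omega> in M. X (t n + u) \<omega> = j \<bar> \<forall>k\<le>n. X (t k) \<omega> = x k) = matrix_exp (u *\<^sub>R Q) $ x n $ j)"

section \<open>Brownian motion and independence of processes\<close>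

definition brownian_motion :: "'a measure \<Rightarrow> (real \<Rightarrow> 'a \<Rightarrow> real) \<Rightarrow> bool" where
  "brownian_motion M W \<longleftrightarrow>
     (\<forall>t\<ge>0. W t \<in> borel_measurable M) \<and>
     (AE \<omega> in M. W 0 \<omega> = 0) \<and>
     (AE \<omega> in M. continuous_on {0..} (\<lambda>t. W t \<omega>)) \<and>
     (\<forall>s t. 0 \<le> s \<longrightarrow> s < t \<longrightarrow>
        distributed M lborel (\<lambda>\<omega>. W t \<omega> - W s \<omega>) (\<lambda>x. ennreal (normal_density 0 (sqrt (t - s)) x))) \<and>
     (\<forall>(n::nat) (t :: nat \<Rightarrow> real). 0 \<le> t 0 \<longrightarrow> (\<forall>k<n. t k < t (Suc k)) \<longrightarrow>
        prob_space.indep_vars M (\<lambda>_. borel) (\<lambda>k \<omega>. W (t (Suc k)) \<omega> - W (t k) \<omega>) {..<n})"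

text \<open>Independence of the \<open>\<sigma>\<close>-algebras generated by the two processes. The library's
  \<^const>\<open>prob_space.indep_var\<close> needs both random variables to have values in the same type.\<close>

definition independent_processes ::
  "'a measure \<Rightarrow> (real \<Rightarrow> 'a \<Rightarrow> 's) \<Rightarrow> (real \<Rightarrow> 'a \<Rightarrow> real) \<Rightarrow> bool" where
  "independent_processes M X W \<longleftrightarrow>
     prob_space.indep_set M
       (sets (vimage_algebra (space M) (\<lambda>\<omega>. restrict (\<lambda>t. X t \<omega>) {0..}) (PiM {0..} (\<lambda>_. count_space UNIV))))
       (sets (vimage_algebra (space M) (\<lambda>\<omega>. restrict (\<lambda>t. W t \<omega>) {0..}) (PiM {0..} (\<lambda>_. borel))))"

section \<open>Conditional densities\<close>

text \<open>Conditioning is on the event that \<open>P\<close> holds; \<^const>\<open>uniform_measure\<close> is the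
  conditional measure. The density is required to be nonnegative because
  \<^const>\<open>ennreal\<close> sends negative numbers to \<open>0\<close>.\<close>

definition has_cond_density ::
  "'a measure \<Rightarrow> ('a \<Rightarrow> bool) \<Rightarrow> ('a \<Rightarrow> real) \<Rightarrow> (real \<Rightarrow> real) \<Rightarrow> bool" where
  "has_cond_density M P Z g \<longleftrightarrow>
     (\<forall>z. 0 \<le> g z) \<and>
     distributed (uniform_measure M {\<omega>\<in>space M. P \<omega>}) lborel Z (\<lambda>z. ennreal (g z))"

section \<open>Modified Bessel functions and the kernels\<close>

definition bessel_B0 :: "real \<Rightarrow> real" where
  "bessel_B0 z = (\<Sum>k. (z\<^sup>2 / 4) ^ k / (fact k)\<^sup>2)"

definition bessel_B1 :: "real \<Rightarrow> real" where
  "bessel_B1 z = z / 2 * (\<Sum>k. (z\<^sup>2 / 4) ^ k / (fact k * fact (k + 1)))"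

text \<open>These are meant for \<open>x \<in> [-h, h]\<close>. At \<open>x = h\<close> the quotient is \<open>0\<close> by the
  convention on division by zero; this is immaterial under the integrals.\<close>

definition q_tilde :: "real \<Rightarrow> real \<Rightarrow> real \<Rightarrow> real" where
  "q_tilde h lam x = lam / 2 *
     (bessel_B0 (lam * sqrt (h\<^sup>2 - x\<^sup>2)) + sqrt ((h + x) / (h - x)) * bessel_B1 (lam * sqrt (h\<^sup>2 - x\<^sup>2)))"

definition q_tilde_plus :: "real \<Rightarrow> real \<Rightarrow> real \<Rightarrow> real" where
  "q_tilde_plus h lam x = lam / 2 * sqrt ((h + x) / (h - x)) * bessel_B1 (lam * sqrt (h\<^sup>2 - x\<^sup>2))"

definition q_tilde_minus :: "real \<Rightarrow> real \<Rightarrow> real \<Rightarrow> real" where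
  "q_tilde_minus h lam x = lam / 2 * bessel_B0 (lam * sqrt (h\<^sup>2 - x\<^sup>2))"

end

theory Submission
  imports Defs
begin

text \<open>Write \<open>\<alpha> = a + b\<^sub>i \<xi>\<close> with \<open>\<xi> = 1\<close> at the state \<open>i\<close> and \<open>\<xi> = -1\<close> at the other state. Then
  \<open>Z = a h + b\<^sub>i T + \<sigma> W\<^sub>h\<close>, where \<open>T\<close> is the time integral of \<open>\<xi>(\<epsilon>)\<close> over \<open>[0, h]\<close>, the position of a
  telegraph process. All three formulas say that \<open>T\<close>, given that \<open>\<epsilon>\<close> starts in \<open>i\<close>, has a point
  mass \<open>exp (-lam h)\<close> at \<open>h\<close> from the paths without jumps, and otherwise the densities
  \<open>exp (-lam h) q\<^sub>+\<close> (end state \<open>i\<close>) and \<open>exp (-lam h) q\<^sub>-\<close> (other end state) on \<open>[-h, h]\<close>, where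
  \<open>q\<^sub>+\<close> and \<open>q\<^sub>-\<close> stand for \<^const>\<open>q_tilde_plus\<close> and \<^const>\<open>q_tilde_minus\<close>. Independent
  normal noise smooths this law by convolution, and division by the probability of the conditioning
  event, which involves \<open>cosh (lam h)\<close> or \<open>sinh (lam h)\<close>, gives the constants.

  The law of \<open>T\<close> is identified through characteristic functions. Let \<open>p(t)\<close> and \<open>m(t)\<close> be the Fourier
  transforms at \<open>u\<close> of the unnormalised law (point mass and \<open>q\<^sub>+\<close>) and of \<open>q\<^sub>-\<close> with horizon \<open>t\<close>. Because
  the Bessel functions satisfy Bessel's differential equation, differentiation under the integral and
  one integration by parts show \<open>p' = \<i> u p + lam m\<close> and \<open>m' = lam p - \<i> u m\<close>
  (\<open>telegraph_diag_derivative\<close>, \<open>telegraph_off_derivative\<close>). These are the Kolmogorov equations of the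
  chain with the phase \<open>\<xi> u\<close>, up to the factor \<open>exp (-lam t)\<close>.

  That the expectation of \<open>exp (\<i> u T)\<close> is given by this solution follows by discretisation
  (\<open>telegraph_char\<close>): on a grid with \<open>n\<close> cells, the Markov property allows to advance one
  cell at a time, each cell contributes an error \<open>O(1/n\<^sup>2)\<close> by Taylor expansion
  (\<open>telegraph_step_error\<close>), and the sampled integrals converge to \<open>T\<close> along every path
  (\<open>riemann_sum_tendsto_lebesgue\<close>). The conclusion is Levy's uniqueness theorem together with the
  factorisation of characteristic functions under independence (\<open>smoothed_cond_density\<close>).\<close>

section \<open>Bessel--Clifford functions\<close>

text \<open>The modified Bessel functions are
  \<open>B\<^sub>0(z) = clifford 0 (z\<^sup>2/4)\<close> and \<open>B\<^sub>1(z) = z/2 * clifford 1 (z\<^sup>2/4)\<close>; in the variable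
  \<open>z\<^sup>2/4\<close> all square roots in the kernels cancel and differentiation only raises the index.\<close>

definition clifford :: "nat \<Rightarrow> real \<Rightarrow> real" where
  "clifford n w = (\<Sum>k. 1 / (fact k * fact (k + n)) * w ^ k)"

lemma clifford_summable: "summable (\<lambda>k. 1 / (fact k * fact (k + n)) * w ^ k :: real)"
proof (rule summable_comparison_test)
  show "\<exists>N. \<forall>k\<ge>N. norm (1 / (fact k * fact (k + n)) * w ^ k) \<le> inverse (fact k) * \<bar>w\<bar> ^ k"
  proof (intro exI[of _ 0] allI impI)
    fix k :: nat
    have "1 \<le> fact k * (fact (k + n) :: real) / fact k" by (simp add: fact_ge_1)
    then have "1 / (fact k * fact (k + n)) \<le> inverse (fact k :: real)"
      by (simp add: divide_simps)
    then have "1 / (fact k * fact (k + n)) * \<bar>w\<bar> ^ k \<le> inverse (fact k) * \<bar>w\<bar> ^ k"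
      by (intro mult_right_mono) auto
    then show "norm (1 / (fact k * fact (k + n)) * w ^ k) \<le> inverse (fact k) * \<bar>w\<bar> ^ k"
      by (simp add: abs_mult power_abs)
  qed
  show "summable (\<lambda>k. inverse (fact k) * \<bar>w\<bar> ^ k)"
    using summable_exp[of "\<bar>w\<bar>"] by simp
qed

lemma clifford_has_derivative:
  "(clifford n has_real_derivative clifford (Suc n) w) (at w)"
proof -
  have "diffs (\<lambda>k. 1 / (fact k * fact (k + n)) :: real) = (\<lambda>k. 1 / (fact k * fact (k + Suc n)))"
    by (simp add: diffs_def fun_eq_iff divide_simps)
  then show ?thesis
    using termdiffs_strong_converges_everywhere[OF clifford_summable[of n], of w]
    by (simp add: clifford_def[abs_def])
qed

lemmas clifford_DERIV [derivative_intros] = clifford_has_derivative[THEN DERIV_chain2]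

text \<open>For \<open>n = 0\<close> this is Bessel's differential equation \<open>w f'' + f' = f\<close> for
  \<open>f = clifford 0\<close>; coefficientwise it is \<open>(k + n)! (k + n + 1) = (k + n + 1)!\<close>.\<close>

lemma clifford_recurrence:
  "clifford n w = real (Suc n) * clifford (Suc n) w + w * clifford (Suc (Suc n)) w"
proof -
  let ?c = "\<lambda>n k. 1 / (fact k * fact (k + n)) :: real"
  have sums: "(\<lambda>k. ?c n k * w ^ k) sums clifford n w" for n
    unfolding clifford_def by (rule summable_sums[OF clifford_summable])
  have shift: "(\<lambda>k. real k * ?c (Suc n) k * w ^ k) sums (w * clifford (Suc (Suc n)) w)"
  proof (rule sums_Suc_imp)
    show "(\<lambda>k. real (Suc k) * ?c (Suc n) (Suc k) * w ^ Suc k) sums (w * clifford (Suc (Suc n)) w)"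
      using sums_mult[OF sums[of "Suc (Suc n)"], of w]
      by (rule back_subst[where P = "\<lambda>f. f sums _"]) (simp add: fun_eq_iff divide_simps del: of_nat_Suc)
  qed simp
  have "(\<lambda>k. ?c n k * w ^ k) sums
    (real (Suc n) * clifford (Suc n) w + w * clifford (Suc (Suc n)) w)"
  proof (rule back_subst[where P = "\<lambda>f. f sums _"])
    show "(\<lambda>k. real (Suc n) * (?c (Suc n) k * w ^ k) + real k * ?c (Suc n) k * w ^ k) sums
      (real (Suc n) * clifford (Suc n) w + w * clifford (Suc (Suc n)) w)"
      by (rule sums_add[OF sums_mult[OF sums[of "Suc n"], of "real (Suc n)"] shift])
    show "(\<lambda>k. real (Suc n) * (?c (Suc n) k * w ^ k) + real k * ?c (Suc n) k * w ^ k) = (\<lambda>k. ?c n k * w ^ k)"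
    proof
      fix k
      define d where "d = ?c (Suc n) k"
      have "?c n k = real (Suc (k + n)) * d"
        by (simp add: d_def divide_simps del: of_nat_Suc)
      then show "real (Suc n) * (?c (Suc n) k * w ^ k) + real k * ?c (Suc n) k * w ^ k = ?c n k * w ^ k"
        unfolding d_def[symmetric] by (simp add: algebra_simps)
    qed
  qed
  with sums[of n] show ?thesis by (rule sums_unique2)
qed

lemma clifford_0 [simp]: "clifford n 0 = 1 / fact n"
  unfolding clifford_def using powser_zero[of "\<lambda>k. 1 / (fact k * fact (k + n)) :: real"] by simp

lemma clifford_continuous [continuous_intros]:
  "continuous_on A f \<Longrightarrow> continuous_on A (\<lambda>x. clifford n (f x))"
  by (rule continuous_on_compose2[of UNIV "clifford n"])
    (auto intro!: DERIV_continuous_on clifford_has_derivative)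

lemma clifford_measurable [measurable]: "clifford n \<in> borel_measurable borel"
  by (intro borel_measurable_continuous_onI clifford_continuous continuous_on_id)

lemma clifford_nonneg: "w \<ge> 0 \<Longrightarrow> clifford n w \<ge> 0"
  unfolding clifford_def by (rule suminf_nonneg[OF clifford_summable]) simp

lemma bessel_B0_clifford: "bessel_B0 z = clifford 0 (z\<^sup>2 / 4)"
  by (simp add: bessel_B0_def clifford_def power2_eq_square)

lemma bessel_B1_clifford: "bessel_B1 z = z / 2 * clifford 1 (z\<^sup>2 / 4)"
  by (simp add: bessel_B1_def clifford_def)

section \<open>Kolmogorov equations for the Fourier transforms of the kernels\<close>

text \<open>Leibniz' rule for \<open>\<integral> F s x dx\<close> over \<open>[-s, s]\<close>, where the substitution \<open>x = s v\<close> moves the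
  dependence on the end points into the integrand. The two forms use integration by parts,
  \<open>F s s - F s (-s) = \<integral> Fx s x dx\<close>, so that only one of the two
  boundary terms is left.\<close>

lemma dilated_integral:
  fixes F Ft Fx :: "real \<Rightarrow> real \<Rightarrow> complex"
  assumes t: "\<And>s v. ((\<lambda>s. F s (s * v)) has_vector_derivative Ft s (s * v) + v *\<^sub>R Fx s (s * v)) (at s)"
    and x: "\<And>s v. ((\<lambda>v. F s (s * v)) has_vector_derivative s *\<^sub>R Fx s (s * v)) (at v)"
    and contt: "continuous_on UNIV (\<lambda>(s, v). Ft s (s * v))"
    and contx: "continuous_on UNIV (\<lambda>(s, v). Fx s (s * v))"
  shows dilated_integral_derivative:
      "((\<lambda>s. s *\<^sub>R integral {-1..1} (\<lambda>v. F s (s * v))) has_vector_derivative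
         2 * F s s + s *\<^sub>R integral {-1..1} (\<lambda>v. Ft s (s * v) - Fx s (s * v))) (at s)"
    and dilated_integral_derivative':
      "((\<lambda>s. s *\<^sub>R integral {-1..1} (\<lambda>v. F s (s * v))) has_vector_derivative
         2 * F s (- s) + s *\<^sub>R integral {-1..1} (\<lambda>v. Ft s (s * v) + Fx s (s * v))) (at s)"
proof -
  have ct: "continuous_on A (\<lambda>v. Ft s (s * v))" and cx: "continuous_on A (\<lambda>v. Fx s (s * v))" for A s
  proof -
    have "continuous_on A (\<lambda>v. (s, v))" by (intro continuous_intros)
    then show "continuous_on A (\<lambda>v. Ft s (s * v))" "continuous_on A (\<lambda>v. Fx s (s * v))"
      using continuous_on_compose2[OF contt, of A "Pair s"]
        continuous_on_compose2[OF contx, of A "Pair s"] by auto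
  qed
  have cF: "continuous_on A (\<lambda>v. F s (s * v))" for A s
    by (rule continuous_on_vector_derivative) (rule has_vector_derivative_at_within[OF x])
  note ints = integrable_continuous_interval[OF ct] integrable_continuous_interval[OF cx]
    integrable_continuous_interval[OF cF]
  have "((\<lambda>v. s *\<^sub>R Fx s (s * v)) has_integral F s (s * 1) - F s (s * -1)) {-1..1}"
    by (rule fundamental_theorem_of_calculus) (auto intro!: has_vector_derivative_at_within[OF x])
  then have parts: "s *\<^sub>R integral {-1..1} (\<lambda>v. Fx s (s * v)) = F s s - F s (- s)"
    by (simp add: has_integral_iff)
  have "((\<lambda>s. integral (cbox (-1) 1) (\<lambda>v. F s (s * v))) has_vector_derivative
      integral (cbox (-1) 1) (\<lambda>v. Ft s (s * v) + v *\<^sub>R Fx s (s * v))) (at s within UNIV)"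
  proof (rule leibniz_rule_vector_derivative)
    have "continuous_on (UNIV \<times> cbox (-1) 1) (\<lambda>p. (\<lambda>(s, v). Ft s (s * v)) p + snd p *\<^sub>R (\<lambda>(s, v). Fx s (s * v)) p)"
      by (intro continuous_intros continuous_on_subset[OF contt] continuous_on_subset[OF contx]) auto
    then show "continuous_on (UNIV \<times> cbox (-1) 1) (\<lambda>(s, v). Ft s (s * v) + v *\<^sub>R Fx s (s * v))"
      by (simp add: case_prod_beta')
  qed (use t ints in auto)
  then have D: "((\<lambda>s. s *\<^sub>R integral {-1..1} (\<lambda>v. F s (s * v))) has_vector_derivative
      s *\<^sub>R integral {-1..1} (\<lambda>v. Ft s (s * v) + v *\<^sub>R Fx s (s * v))
       + integral {-1..1} (\<lambda>v. F s (s * v))) (at s)"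
    by (auto intro!: derivative_eq_intros)
  have "((\<lambda>v. F s (s * v) + v *\<^sub>R s *\<^sub>R Fx s (s * v)) has_integral 1 *\<^sub>R F s (s * 1) - (-1) *\<^sub>R F s (s * -1)) {-1..1}"
    by (rule fundamental_theorem_of_calculus)
      (auto intro!: derivative_eq_intros has_vector_derivative_at_within[OF x])
  moreover have "((\<lambda>v. F s (s * v) + v *\<^sub>R s *\<^sub>R Fx s (s * v)) has_integral
     integral {-1..1} (\<lambda>v. F s (s * v)) + s *\<^sub>R integral {-1..1} (\<lambda>v. v *\<^sub>R Fx s (s * v))) {-1..1}"
  proof -
    have "(\<lambda>v. v *\<^sub>R Fx s (s * v)) integrable_on {-1..1}"
      by (intro integrable_continuous_interval continuous_intros cx)
    from has_integral_add[OF integrable_integral[OF ints(3)[of s]] has_integral_cmul[OF integrable_integral[OF this], of s]]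
    show ?thesis by (simp add: mult.commute)
  qed
  ultimately have "integral {-1..1} (\<lambda>v. F s (s * v)) + s *\<^sub>R integral {-1..1} (\<lambda>v. v *\<^sub>R Fx s (s * v)) = F s s + F s (- s)"
    by (auto dest: has_integral_unique)
  moreover have "integral {-1..1} (\<lambda>v. Ft s (s * v) + v *\<^sub>R Fx s (s * v)) =
    integral {-1..1} (\<lambda>v. Ft s (s * v)) + integral {-1..1} (\<lambda>v. v *\<^sub>R Fx s (s * v))"
    by (intro Henstock_Kurzweil_Integration.integral_add ints)
      (intro integrable_continuous_interval continuous_intros cx)
  ultimately have "s *\<^sub>R integral {-1..1} (\<lambda>v. Ft s (s * v) + v *\<^sub>R Fx s (s * v)) + integral {-1..1} (\<lambda>v. F s (s * v))
      = F s s + F s (- s) + s *\<^sub>R integral {-1..1} (\<lambda>v. Ft s (s * v))"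
    by (simp add: scaleR_right_distrib flip: \<open>_ = F s s + F s (- s)\<close>)
  with D have *: "((\<lambda>s. s *\<^sub>R integral {-1..1} (\<lambda>v. F s (s * v))) has_vector_derivative
         F s s + F s (- s) + s *\<^sub>R integral {-1..1} (\<lambda>v. Ft s (s * v))) (at s)"
    by simp
  have split: "integral {-1..1} (\<lambda>v. Ft s (s * v) - Fx s (s * v)) =
      integral {-1..1} (\<lambda>v. Ft s (s * v)) - integral {-1..1} (\<lambda>v. Fx s (s * v))"
    "integral {-1..1} (\<lambda>v. Ft s (s * v) + Fx s (s * v)) =
      integral {-1..1} (\<lambda>v. Ft s (s * v)) + integral {-1..1} (\<lambda>v. Fx s (s * v))"
    by (intro Henstock_Kurzweil_Integration.integral_diff Henstock_Kurzweil_Integration.integral_add ints)+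
  from * show "((\<lambda>s. s *\<^sub>R integral {-1..1} (\<lambda>v. F s (s * v))) has_vector_derivative
         2 * F s s + s *\<^sub>R integral {-1..1} (\<lambda>v. Ft s (s * v) - Fx s (s * v))) (at s)"
    unfolding split scaleR_right_diff_distrib parts by (simp add: algebra_simps)
  from * show "((\<lambda>s. s *\<^sub>R integral {-1..1} (\<lambda>v. F s (s * v))) has_vector_derivative
         2 * F s (- s) + s *\<^sub>R integral {-1..1} (\<lambda>v. Ft s (s * v) + Fx s (s * v))) (at s)"
    unfolding split scaleR_right_distrib parts by (simp add: algebra_simps)
qed

lemma has_vector_derivative_iexp [derivative_intros]:
  assumes "(f has_real_derivative f') (at x within S)"
  shows "((\<lambda>x. iexp (f x)) has_vector_derivative (\<i> * of_real f') * iexp (f x)) (at x within S)"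
proof -
  have "((\<lambda>z. exp (\<i> * z)) has_field_derivative \<i> * exp (\<i> * of_real (f x))) (at (complex_of_real (f x)) within S')" for S'
    by (auto intro!: derivative_eq_intros)
  from field_vector_diff_chain_within[of "\<lambda>x. of_real (f x)" "of_real f'" x S, OF _ this] assms
  show ?thesis
    by (simp add: o_def mult.assoc mult.left_commute has_vector_derivative_of_real has_real_derivative_iff_has_vector_derivative)
qed

text \<open>Up to the factor \<open>exp (-lam t)\<close>, this will be the characteristic function at \<open>u\<close> of the time
  integral up to \<open>t\<close> of a process that jumps between \<open>1\<close> and \<open>-1\<close> at rate \<open>lam\<close>, on the event that
  start and end states differ. It is the Fourier transform of \<open>lam/2 B\<^sub>0(lam \<surd>(t\<^sup>2 - x\<^sup>2))\<close> on
  \<open>[-t, t]\<close>, written over \<open>[-1, 1]\<close> so that it is defined and smooth for all real \<open>t\<close>.\<close>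

definition telegraph_off :: "real \<Rightarrow> real \<Rightarrow> real \<Rightarrow> complex" where
  "telegraph_off u lam t = (lam / 2) *\<^sub>R t *\<^sub>R integral {-1..1}
     (\<lambda>v. iexp (u * (t * v)) * of_real (clifford 0 (lam\<^sup>2 * (t\<^sup>2 - (t * v)\<^sup>2) / 4)))"

text \<open>The same for the event that both states are the one with value \<open>1\<close>. The first summand comes
  from the paths without a jump.\<close>

definition telegraph_diag :: "real \<Rightarrow> real \<Rightarrow> real \<Rightarrow> complex" where
  "telegraph_diag u lam t = iexp (u * t) + (lam\<^sup>2 / 4) *\<^sub>R t *\<^sub>R integral {-1..1}
     (\<lambda>v. iexp (u * (t * v)) * of_real ((t + t * v) * clifford 1 (lam\<^sup>2 * (t\<^sup>2 - (t * v)\<^sup>2) / 4)))"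

lemma telegraph_diag_0 [simp]: "telegraph_diag u lam 0 = 1"
  by (simp add: telegraph_diag_def)

lemma telegraph_off_0 [simp]: "telegraph_off u lam 0 = 0"
  by (simp add: telegraph_off_def)

lemma telegraph_off_uminus: "telegraph_off (- u) lam h = telegraph_off u lam h"
proof -
  have "integral {-1..1} (\<lambda>v. iexp (- u * (h * v)) * of_real (clifford 0 (lam\<^sup>2 * (h\<^sup>2 - (h * v)\<^sup>2) / 4))) =
    integral {-1..1} (\<lambda>v. iexp (u * (h * v)) * of_real (clifford 0 (lam\<^sup>2 * (h\<^sup>2 - (h * v)\<^sup>2) / 4)))"
    using Henstock_Kurzweil_Integration.integral_reflect_real[of 1 "-1"
        "\<lambda>v. iexp (u * (h * v)) * of_real (clifford 0 (lam\<^sup>2 * (h\<^sup>2 - (h * v)\<^sup>2) / 4))"] by simp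
  then show ?thesis by (simp add: telegraph_off_def)
qed

text \<open>This equation and the next one are the Kolmogorov equations for \<open>exp (lam t)\<close> times the two
  characteristic functions.\<close>

lemma telegraph_off_derivative:
  "(telegraph_off u lam has_vector_derivative
     of_real lam * telegraph_diag u lam t - \<i> * of_real u * telegraph_off u lam t) (at t)"
proof -
  define C where "C n s x = clifford n (lam\<^sup>2 * (s\<^sup>2 - x\<^sup>2) / 4)" for n s x
  define F where "F s x = iexp (u * x) * of_real (C 0 s x)" for s x
  define Ft where "Ft s x = iexp (u * x) * of_real (C 1 s x * (lam\<^sup>2 * s / 2))" for s x
  define Fx where "Fx s x = iexp (u * x) * (\<i> * of_real u * of_real (C 0 s x) - of_real (C 1 s x * (lam\<^sup>2 * x / 2)))" for s x
  have cont: "continuous_on A (\<lambda>v. C n s (s * v))" for A n s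
    unfolding C_def by (intro continuous_intros) auto
  have contI: "continuous_on A (\<lambda>v. iexp (u * (s * v)))" for A s
    by (intro continuous_intros)
  have "((\<lambda>s. s *\<^sub>R integral {-1..1} (\<lambda>v. F s (s * v))) has_vector_derivative
         2 * F t t + t *\<^sub>R integral {-1..1} (\<lambda>v. Ft t (t * v) - Fx t (t * v))) (at t)"
  proof (rule dilated_integral_derivative)
    show "((\<lambda>s. F s (s * v)) has_vector_derivative Ft s (s * v) + v *\<^sub>R Fx s (s * v)) (at s)" for s v
      unfolding F_def Ft_def Fx_def C_def
      by (rule has_vector_derivative_eq_rhs, (rule derivative_eq_intros has_vector_derivative_of_real refl | simp)+)
        (simp add: scaleR_conv_of_real field_simps power2_eq_square)
    show "((\<lambda>v. F s (s * v)) has_vector_derivative s *\<^sub>R Fx s (s * v)) (at v)" for s v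
      unfolding F_def Ft_def Fx_def C_def
      by (rule has_vector_derivative_eq_rhs, (rule derivative_eq_intros has_vector_derivative_of_real refl | simp)+)
        (simp add: scaleR_conv_of_real field_simps power2_eq_square)
    show "continuous_on UNIV (\<lambda>(s, v). Ft s (s * v))" "continuous_on UNIV (\<lambda>(s, v). Fx s (s * v))"
      unfolding Ft_def Fx_def C_def case_prod_beta by (intro continuous_intros; simp)+
  qed
  moreover define J0 where "J0 = integral {-1..1} (\<lambda>v. F t (t * v))"
  moreover define J1 where "J1 = integral {-1..1} (\<lambda>v. iexp (u * (t * v)) * of_real ((t + t * v) * C 1 t (t * v)))"
  moreover have "integral {-1..1} (\<lambda>v. Ft t (t * v) - Fx t (t * v)) =
      of_real (lam\<^sup>2 / 2) * integral {-1..1} (\<lambda>v. iexp (u * (t * v)) * of_real ((t + t * v) * C 1 t (t * v)))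
      - \<i> * of_real u * integral {-1..1} (\<lambda>v. F t (t * v))"
  proof -
    have "integral {-1..1} (\<lambda>v. Ft t (t * v) - Fx t (t * v)) =
      integral {-1..1} (\<lambda>v. of_real (lam\<^sup>2 / 2) * (iexp (u * (t * v)) * of_real ((t + t * v) * C 1 t (t * v)))
          - \<i> * of_real u * F t (t * v))"
      unfolding F_def Ft_def Fx_def by (rule integral_cong) (simp add: field_simps)
    also have "\<dots> = of_real (lam\<^sup>2 / 2) * integral {-1..1} (\<lambda>v. iexp (u * (t * v)) * of_real ((t + t * v) * C 1 t (t * v)))
      - \<i> * of_real u * integral {-1..1} (\<lambda>v. F t (t * v))"
      unfolding F_def
      by (subst Henstock_Kurzweil_Integration.integral_diff)
        (auto intro!: integrable_continuous_interval continuous_intros cont contI)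
    finally show ?thesis .
  qed
  ultimately have "((\<lambda>s. s *\<^sub>R integral {-1..1} (\<lambda>v. F s (s * v))) has_vector_derivative
      2 * F t t + t *\<^sub>R (of_real (lam\<^sup>2 / 2) * J1 - \<i> * of_real u * J0)) (at t)"
    unfolding J0_def J1_def by simp
  from bounded_linear.has_vector_derivative[OF bounded_linear_scaleR_right this, of "lam / 2"]
  have "(telegraph_off u lam has_vector_derivative
     (lam / 2) *\<^sub>R (2 * F t t + t *\<^sub>R (of_real (lam\<^sup>2 / 2) * J1 - \<i> * of_real u * J0))) (at t)"
    unfolding telegraph_off_def[abs_def] F_def C_def .
  moreover have "telegraph_off u lam t = (lam / 2) *\<^sub>R t *\<^sub>R J0"
    by (simp add: telegraph_off_def J0_def F_def C_def)
  moreover have "telegraph_diag u lam t = F t t + (lam\<^sup>2 / 4) *\<^sub>R t *\<^sub>R J1"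
    by (simp add: telegraph_diag_def J1_def F_def C_def)
  ultimately show ?thesis
    by (elim has_vector_derivative_eq_rhs)
      (simp add: scaleR_conv_of_real field_simps power2_eq_square)
qed

text \<open>Here the derivatives of the kernel combine, through Bessel's equation, to the kernel of
  \<^const>\<open>telegraph_off\<close>; the boundary term at \<open>x = -t\<close> vanishes because of the factor \<open>t + x\<close>.\<close>

lemma telegraph_diag_derivative:
  "(telegraph_diag u lam has_vector_derivative
     \<i> * of_real u * telegraph_diag u lam t + of_real lam * telegraph_off u lam t) (at t)"
proof -
  define C where "C n s x = clifford n (lam\<^sup>2 * (s\<^sup>2 - x\<^sup>2) / 4)" for n s x
  define F where "F s x = iexp (u * x) * of_real ((s + x) * C 1 s x)" for s x
  define Ft where "Ft s x = iexp (u * x) * of_real (C 1 s x + (s + x) * (C 2 s x * (lam\<^sup>2 * s / 2)))" for s x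
  define Fx where "Fx s x = iexp (u * x) * (\<i> * of_real u * of_real ((s + x) * C 1 s x)
     + of_real (C 1 s x - (s + x) * (C 2 s x * (lam\<^sup>2 * x / 2))))" for s x
  have cont: "continuous_on A (\<lambda>v. C n s (s * v))" for A n s
    unfolding C_def by (intro continuous_intros) auto
  have contI: "continuous_on A (\<lambda>v. iexp (u * (s * v)))" for A s
    by (intro continuous_intros)
  have "((\<lambda>s. s *\<^sub>R integral {-1..1} (\<lambda>v. F s (s * v))) has_vector_derivative
         2 * F t (- t) + t *\<^sub>R integral {-1..1} (\<lambda>v. Ft t (t * v) + Fx t (t * v))) (at t)"
  proof (rule dilated_integral_derivative')
    show "((\<lambda>s. F s (s * v)) has_vector_derivative Ft s (s * v) + v *\<^sub>R Fx s (s * v)) (at s)" for s v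
      unfolding F_def Ft_def Fx_def C_def
      by (rule has_vector_derivative_eq_rhs, (rule derivative_eq_intros has_vector_derivative_of_real refl | simp)+)
        (simp add: scaleR_conv_of_real field_simps power2_eq_square numeral_2_eq_2)
    show "((\<lambda>v. F s (s * v)) has_vector_derivative s *\<^sub>R Fx s (s * v)) (at v)" for s v
      unfolding F_def Ft_def Fx_def C_def
      by (rule has_vector_derivative_eq_rhs, (rule derivative_eq_intros has_vector_derivative_of_real refl | simp)+)
        (simp add: scaleR_conv_of_real field_simps power2_eq_square numeral_2_eq_2)
    show "continuous_on UNIV (\<lambda>(s, v). Ft s (s * v))" "continuous_on UNIV (\<lambda>(s, v). Fx s (s * v))"
      unfolding Ft_def Fx_def C_def case_prod_beta by (intro continuous_intros; simp)+
  qed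
  moreover define J0 where "J0 = integral {-1..1} (\<lambda>v. iexp (u * (t * v)) * of_real (C 0 t (t * v)))"
  moreover define J1 where "J1 = integral {-1..1} (\<lambda>v. F t (t * v))"
  moreover have "integral {-1..1} (\<lambda>v. Ft t (t * v) + Fx t (t * v)) =
      2 * integral {-1..1} (\<lambda>v. iexp (u * (t * v)) * of_real (C 0 t (t * v)))
      + \<i> * of_real u * integral {-1..1} (\<lambda>v. F t (t * v))"
  proof -
    have rec: "2 * C 0 s x = 2 * C 1 s x + (s + x) * (C 2 s x * (lam\<^sup>2 * (s - x) / 2))" for s x
      unfolding C_def by (subst clifford_recurrence) (simp add: numeral_2_eq_2 field_simps power2_eq_square)
    have "Ft s x + Fx s x = 2 * (iexp (u * x) * of_real (C 0 s x)) + \<i> * of_real u * F s x" for s x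
    proof -
      have "Ft s x + Fx s x = iexp (u * x) * of_real (2 * C 1 s x + (s + x) * (C 2 s x * (lam\<^sup>2 * (s - x) / 2)))
          + \<i> * of_real u * F s x"
        unfolding F_def Ft_def Fx_def by (simp add: field_simps power2_eq_square)
      then show ?thesis unfolding rec[symmetric] by simp
    qed
    then show ?thesis
      unfolding F_def
      by (simp only:, subst Henstock_Kurzweil_Integration.integral_add)
        (auto intro!: integrable_continuous_interval continuous_intros cont contI)
  qed
  moreover have "F t (- t) = 0" by (simp add: F_def)
  ultimately have "((\<lambda>s. s *\<^sub>R integral {-1..1} (\<lambda>v. F s (s * v))) has_vector_derivative
      t *\<^sub>R (2 * J0 + \<i> * of_real u * J1)) (at t)"
    unfolding J0_def J1_def by simp
  note * = bounded_linear.has_vector_derivative[OF bounded_linear_scaleR_right this, of "lam\<^sup>2 / 4"]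
  have "((\<lambda>t. iexp (u * t)) has_vector_derivative \<i> * of_real u * iexp (u * t)) (at t)"
    by (rule has_vector_derivative_iexp) (auto intro!: derivative_eq_intros)
  from has_vector_derivative_add[OF this *]
  have "(telegraph_diag u lam has_vector_derivative
     \<i> * of_real u * iexp (u * t) + (lam\<^sup>2 / 4) *\<^sub>R t *\<^sub>R (2 * J0 + \<i> * of_real u * J1)) (at t)"
    unfolding telegraph_diag_def[abs_def] F_def C_def .
  moreover have "telegraph_off u lam t = (lam / 2) *\<^sub>R t *\<^sub>R J0"
    by (simp add: telegraph_off_def J0_def F_def C_def)
  moreover have "telegraph_diag u lam t = iexp (u * t) + (lam\<^sup>2 / 4) *\<^sub>R t *\<^sub>R J1"
    by (simp add: telegraph_diag_def J1_def F_def C_def)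
  ultimately show ?thesis
    by (elim has_vector_derivative_eq_rhs)
      (simp add: scaleR_conv_of_real field_simps power2_eq_square)
qed

section \<open>The kernels and their Fourier transforms\<close>

lemma q_tilde_minus_eq: "y \<in> {-h..h} \<Longrightarrow> q_tilde_minus h lam y = lam / 2 * clifford 0 (lam\<^sup>2 * (h\<^sup>2 - y\<^sup>2) / 4)"
proof -
  assume "y \<in> {-h..h}"
  then have "y\<^sup>2 \<le> h\<^sup>2" by (intro power2_le_iff_abs_le[THEN iffD2]) auto
  then show ?thesis by (simp add: q_tilde_minus_def bessel_B0_clifford power_mult_distrib)
qed

text \<open>The factor \<open>\<surd>((h + y) / (h - y))\<close> and the factor \<open>\<surd>(h\<^sup>2 - y\<^sup>2)\<close> of \<open>B\<^sub>1\<close> multiply to \<open>h + y\<close>. At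
  \<open>y = h\<close> the left-hand side is \<open>0\<close> by the convention on division by zero.\<close>

lemma q_tilde_plus_eq:
  assumes "y \<in> {-h..h}" "y \<noteq> h"
  shows "q_tilde_plus h lam y = lam\<^sup>2 / 4 * ((h + y) * clifford 1 (lam\<^sup>2 * (h\<^sup>2 - y\<^sup>2) / 4))"
proof -
  have pos: "0 < h - y" "0 \<le> h + y" using assms by auto
  have prod: "h\<^sup>2 - y\<^sup>2 = (h - y) * (h + y)" by (simp add: power2_eq_square algebra_simps)
  have "sqrt ((h + y) / (h - y)) * sqrt (h\<^sup>2 - y\<^sup>2) = sqrt ((h + y)\<^sup>2)"
    unfolding real_sqrt_mult[symmetric] prod using pos by (simp add: power2_eq_square)
  also have "\<dots> = h + y" using pos by simp
  finally have sq: "sqrt ((h + y) / (h - y)) * sqrt (h\<^sup>2 - y\<^sup>2) = h + y" .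
  have "(lam * sqrt (h\<^sup>2 - y\<^sup>2))\<^sup>2 = lam\<^sup>2 * (h\<^sup>2 - y\<^sup>2)"
    using pos unfolding power_mult_distrib prod by simp
  then have "q_tilde_plus h lam y = lam / 2 * sqrt ((h + y) / (h - y)) *
      (lam * sqrt (h\<^sup>2 - y\<^sup>2) / 2 * clifford 1 (lam\<^sup>2 * (h\<^sup>2 - y\<^sup>2) / 4))"
    by (simp only: q_tilde_plus_def bessel_B1_clifford)
  then have "q_tilde_plus h lam y = lam\<^sup>2 / 4 * ((sqrt ((h + y) / (h - y)) * sqrt (h\<^sup>2 - y\<^sup>2)) * clifford 1 (lam\<^sup>2 * (h\<^sup>2 - y\<^sup>2) / 4))"
    by (simp add: power2_eq_square[of lam])
  then show ?thesis unfolding sq .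
qed

lemma q_tilde_eq: "q_tilde h lam y = q_tilde_plus h lam y + q_tilde_minus h lam y"
  by (simp add: q_tilde_def q_tilde_plus_def q_tilde_minus_def algebra_simps)

lemma q_tilde_measurable [measurable]:
  "q_tilde_plus h lam \<in> borel_measurable borel" "q_tilde_minus h lam \<in> borel_measurable borel"
  unfolding q_tilde_plus_def[abs_def] q_tilde_minus_def[abs_def] bessel_B0_clifford[abs_def] bessel_B1_clifford[abs_def]
  by measurable

lemma q_tilde_nonneg:
  assumes "lam > 0" "y \<in> {-h..h}"
  shows "0 \<le> q_tilde_plus h lam y" "0 \<le> q_tilde_minus h lam y"
proof -
  have B: "0 \<le> bessel_B0 z" "0 \<le> z \<Longrightarrow> 0 \<le> bessel_B1 z" for z
    by (auto simp: bessel_B0_clifford bessel_B1_clifford intro!: mult_nonneg_nonneg clifford_nonneg)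
  have "y\<^sup>2 \<le> h\<^sup>2" using assms by (intro power2_le_iff_abs_le[THEN iffD2]) auto
  with assms show "0 \<le> q_tilde_plus h lam y" "0 \<le> q_tilde_minus h lam y"
    unfolding q_tilde_plus_def q_tilde_minus_def by (auto intro!: mult_nonneg_nonneg B divide_nonneg_nonneg)
qed

lemma set_integral_dilate:
  fixes f :: "real \<Rightarrow> complex"
  assumes h: "h > 0" and f: "continuous_on {-h..h} f"
  shows "(LINT y:{-h..h}|lborel. f y) = h *\<^sub>R integral {-1..1} (\<lambda>v. f (h * v))"
proof -
  have dil: "h * v \<in> {-h..h} \<longleftrightarrow> v \<in> {-1..1}" for v
    using mult_le_cancel_left_pos[OF h, of "-1" v] mult_le_cancel_left_pos[OF h, of v 1] by simp
  have "(LINT y:{-h..h}|lborel. f y) = h *\<^sub>R (LINT v:{-1..1}|lborel. f (h * v))"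
    unfolding set_lebesgue_integral_def
    using h dil by (subst lborel_integral_real_affine[where c = h and t = 0]) (auto simp: indicator_def)
  moreover have "set_integrable lborel {-1..1} (\<lambda>v. f (h * v))"
    by (intro borel_integrable_atLeastAtMost' continuous_on_compose2[OF f])
      (use dil in \<open>auto intro!: continuous_intros\<close>)
  then have "(LINT v:{-1..1}|lborel. f (h * v)) = integral {-1..1} (\<lambda>v. f (h * v))"
    by (rule set_borel_integral_eq_integral)
  ultimately show ?thesis by simp
qed

lemma telegraph_off_eq_fourier:
  assumes "h > 0"
  shows "telegraph_off u lam h = (LINT y:{-h..h}|lborel. iexp (u * y) * of_real (q_tilde_minus h lam y))"
    and "set_integrable lborel {-h..h} (q_tilde_minus h lam)"
proof -
  have "(LINT y:{-h..h}|lborel. iexp (u * y) * of_real (q_tilde_minus h lam y)) =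
    (LINT y:{-h..h}|lborel. of_real (lam / 2) * (iexp (u * y) * of_real (clifford 0 (lam\<^sup>2 * (h\<^sup>2 - y\<^sup>2) / 4))))"
    by (intro set_lebesgue_integral_cong) (auto simp: q_tilde_minus_eq)
  also have "\<dots> = of_real (lam / 2) * (LINT y:{-h..h}|lborel. iexp (u * y) * of_real (clifford 0 (lam\<^sup>2 * (h\<^sup>2 - y\<^sup>2) / 4)))"
    by (rule set_integral_mult_right)
  also have "\<dots> = telegraph_off u lam h"
    unfolding telegraph_off_def
    by (subst set_integral_dilate[OF assms]) (auto intro!: continuous_intros simp: scaleR_conv_of_real)
  finally show "telegraph_off u lam h = (LINT y:{-h..h}|lborel. iexp (u * y) * of_real (q_tilde_minus h lam y))" ..
  have "set_integrable lborel {-h..h} (\<lambda>y. lam / 2 * clifford 0 (lam\<^sup>2 * (h\<^sup>2 - y\<^sup>2) / 4))"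
    by (intro borel_integrable_atLeastAtMost' continuous_intros) auto
  then show "set_integrable lborel {-h..h} (q_tilde_minus h lam)"
    by (subst set_integrable_cong[OF refl refl q_tilde_minus_eq]) auto
qed

lemma telegraph_diag_eq_fourier:
  assumes "h > 0"
  shows "telegraph_diag u lam h = iexp (u * h) + (LINT y:{-h..h}|lborel. iexp (u * y) * of_real (q_tilde_plus h lam y))"
    and "set_integrable lborel {-h..h} (q_tilde_plus h lam)"
proof -
  have AE: "AE y in lborel. y \<noteq> h" by (rule AE_lborel_singleton)
  have "(LINT y:{-h..h}|lborel. iexp (u * y) * of_real (q_tilde_plus h lam y)) =
    (LINT y:{-h..h}|lborel. of_real (lam\<^sup>2 / 4) * (iexp (u * y) * of_real ((h + y) * clifford 1 (lam\<^sup>2 * (h\<^sup>2 - y\<^sup>2) / 4))))"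
  proof (rule set_lebesgue_integral_cong_AE)
    show "AE y\<in>{-h..h} in lborel. iexp (u * y) * of_real (q_tilde_plus h lam y) =
      of_real (lam\<^sup>2 / 4) * (iexp (u * y) * of_real ((h + y) * clifford 1 (lam\<^sup>2 * (h\<^sup>2 - y\<^sup>2) / 4)))"
      using AE by eventually_elim (auto simp: q_tilde_plus_eq)
  qed measurable
  also have "\<dots> = of_real (lam\<^sup>2 / 4) * (LINT y:{-h..h}|lborel. iexp (u * y) * of_real ((h + y) * clifford 1 (lam\<^sup>2 * (h\<^sup>2 - y\<^sup>2) / 4)))"
    by (rule set_integral_mult_right)
  also have "\<dots> = telegraph_diag u lam h - iexp (u * h)"
    unfolding telegraph_diag_def
    by (subst set_integral_dilate[OF assms]) (auto intro!: continuous_intros simp: scaleR_conv_of_real)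
  finally show "telegraph_diag u lam h = iexp (u * h) + (LINT y:{-h..h}|lborel. iexp (u * y) * of_real (q_tilde_plus h lam y))"
    by simp
  have "set_integrable lborel {-h..h} (\<lambda>y. lam\<^sup>2 / 4 * ((h + y) * clifford 1 (lam\<^sup>2 * (h\<^sup>2 - y\<^sup>2) / 4)))"
    by (intro borel_integrable_atLeastAtMost' continuous_intros) auto
  also have "?this \<longleftrightarrow> set_integrable lborel {-h..h} (q_tilde_plus h lam)"
  proof (rule set_integrable_cong_AE)
    show "AE y\<in>{-h..h} in lborel. lam\<^sup>2 / 4 * ((h + y) * clifford 1 (lam\<^sup>2 * (h\<^sup>2 - y\<^sup>2) / 4)) = q_tilde_plus h lam y"
      using AE by eventually_elim (auto simp: q_tilde_plus_eq)
  qed measurable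
  finally show "set_integrable lborel {-h..h} (q_tilde_plus h lam)" .
qed

section \<open>The Markov property and the two-state chain\<close>

abbreviation (input) telegraph_sign :: "2 \<Rightarrow> 2 \<Rightarrow> real" where
  "telegraph_sign j x \<equiv> (if x = j then 1 else -1)"

abbreviation (input) telegraph_intensity :: "real \<Rightarrow> real^2^2" where
  "telegraph_intensity lam \<equiv> vector [vector [-lam, lam], vector [lam, -lam]]"

lemma matrix_exp_telegraph:
  "matrix_exp (u *\<^sub>R (vector [vector [-lam, lam], vector [lam, -lam]] :: real^2^2)) $ x $ y =
     exp (- (lam * u)) * (if x = y then cosh (lam * u) else sinh (lam * u))"
proof -
  define B where "B = u *\<^sub>R (vector [vector [-lam, lam], vector [lam, -lam]] :: real^2^2)"
  \<comment> \<open>The eigenvalues are \<open>0\<close> and \<open>r\<close>, so every power is a combination of \<open>0 ^ k\<close> and \<open>r ^ k\<close>.\<close>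
  define r where "r = - (2 * (lam * u))"
  have B: "B $ 1 $ 1 = r / 2" "B $ 1 $ 2 = - (r / 2)" "B $ 2 $ 1 = - (r / 2)" "B $ 2 $ 2 = r / 2"
    by (simp_all add: B_def r_def)
  have pow: "((**) B ^^ k) (mat 1) $ x $ y = (if x = y then (0 ^ k + r ^ k) / 2 else (0 ^ k - r ^ k) / 2)" for k x y
  proof (induction k arbitrary: x y)
    case (Suc k)
    have "((**) B ^^ Suc k) (mat 1) $ x $ y =
      B $ x $ 1 * ((**) B ^^ k) (mat 1) $ 1 $ y + B $ x $ 2 * ((**) B ^^ k) (mat 1) $ 2 $ y"
      by (simp add: matrix_matrix_mult_def sum_2)
    also have "\<dots> = (if x = y then (0 ^ Suc k + r ^ Suc k) / 2 else (0 ^ Suc k - r ^ Suc k) / 2)"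
      unfolding Suc using exhaust_2[of x] exhaust_2[of y] by (auto simp: B field_simps)
    finally show ?case .
  qed (simp add: mat_def)
  define S :: "real^2^2" where "S = (\<chi> x y. if x = y then (1 + exp r) / 2 else (1 - exp r) / 2)"
  have "(\<lambda>k. (1 / fact k) *\<^sub>R (((**) B ^^ k) (mat 1))) sums S"
    unfolding sums_def
  proof (intro vec_tendstoI)
    fix i j :: 2
    have "(\<lambda>k. inverse (fact k) * 0 ^ k :: real) sums 1" "(\<lambda>k. inverse (fact k) * r ^ k) sums exp r"
      using exp_converges[of "0::real"] exp_converges[of r] by simp_all
    then have "(\<lambda>k. ((1 / fact k) *\<^sub>R (((**) B ^^ k) (mat 1))) $ i $ j) sums (S $ i $ j)"
    proof (cases "i = j")
      case True
      from \<open>(\<lambda>k. inverse (fact k) * 0 ^ k :: real) sums 1\<close> \<open>(\<lambda>k. inverse (fact k) * r ^ k) sums exp r\<close>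
      have "(\<lambda>k. (inverse (fact k) * 0 ^ k + inverse (fact k) * r ^ k) / 2) sums ((1 + exp r) / 2)"
        by (intro sums_divide sums_add)
      with True show ?thesis by (simp add: pow S_def inverse_eq_divide add_divide_distrib mult.commute)
    next
      case False
      from \<open>(\<lambda>k. inverse (fact k) * 0 ^ k :: real) sums 1\<close> \<open>(\<lambda>k. inverse (fact k) * r ^ k) sums exp r\<close>
      have "(\<lambda>k. (inverse (fact k) * 0 ^ k - inverse (fact k) * r ^ k) / 2) sums ((1 - exp r) / 2)"
        by (intro sums_divide sums_diff)
      with False show ?thesis by (simp add: pow S_def inverse_eq_divide diff_divide_distrib mult.commute)
    qed
    then show "(\<lambda>n. (\<Sum>k<n. (1 / fact k) *\<^sub>R (((**) B ^^ k) (mat 1))) $ i $ j) \<longlonglongrightarrow> S $ i $ j"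
      by (simp add: sums_def)
  qed
  then have "matrix_exp B = S"
    unfolding matrix_exp_def by (rule sums_unique[symmetric])
  moreover have "exp (- (lam * u)) * cosh (lam * u) = (1 + exp r) / 2"
    "exp (- (lam * u)) * sinh (lam * u) = (1 - exp r) / 2"
    by (simp_all add: cosh_def sinh_def r_def distrib_left right_diff_distrib flip: exp_add)
  ultimately show ?thesis
    by (simp add: S_def flip: B_def)
qed

text \<open>The Markov property at time \<open>t n\<close>, for functions of the observed history instead of events. The
  history takes finitely many values, so both sides are finite sums over the possible histories.\<close>

lemma markov_chain_expectation:
  fixes X :: "real \<Rightarrow> 'a \<Rightarrow> 's::finite" and F :: "(nat \<Rightarrow> 's) \<Rightarrow> complex" and G :: "'s \<Rightarrow> complex"
  assumes "prob_space M" "markov_chain M Q X" "0 \<le> t 0" "\<And>k. k < n \<Longrightarrow> t k < t (Suc k)" "0 \<le> u"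
  shows "(\<integral>\<omega>. F (\<lambda>k\<in>{..n}. X (t k) \<omega>) * G (X (t n + u) \<omega>) \<partial>M) =
    (\<integral>\<omega>. F (\<lambda>k\<in>{..n}. X (t k) \<omega>) * (\<Sum>j\<in>UNIV. of_real (matrix_exp (u *\<^sub>R Q) $ X (t n) \<omega> $ j) * G j) \<partial>M)"
proof -
  interpret prob_space M by fact
  have nonneg: "0 \<le> t k" if "k \<le> n" for k
    using that
  proof (induction k)
    case (Suc k)
    then show ?case using assms(4)[of k] by simp
  qed (use assms(3) in simp)
  have X[measurable]: "X s \<in> measurable M (count_space UNIV)" if "0 \<le> s" for s
    using assms(2) that by (auto simp: markov_chain_def)
  have Xt: "X (t k) \<in> measurable M (count_space UNIV)" if "k \<le> n" for k
    by (rule X[OF nonneg[OF that]])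
  have Xu: "X (t n + u) \<in> measurable M (count_space UNIV)"
    using nonneg[of n] assms(5) by (intro X) simp
  define A where "A x = {\<omega>\<in>space M. \<forall>k\<le>n. X (t k) \<omega> = x k}" for x
  define B where "B x j = {\<omega>\<in>space M. X (t n + u) \<omega> = j \<and> (\<forall>k\<le>n. X (t k) \<omega> = x k)}" for x j
  have A[measurable]: "A x \<in> sets M" for x
  proof -
    have "A x = (\<Inter>k\<in>{..n}. X (t k) -` {x k} \<inter> space M)" by (auto simp: A_def)
    also have "\<dots> \<in> sets M" using Xt by (intro sets.finite_INT) (auto intro: measurable_sets)
    finally show ?thesis .
  qed
  have B[measurable]: "B x j \<in> sets M" for x j
  proof -
    have "B x j = A x \<inter> (X (t n + u) -` {j} \<inter> space M)" by (auto simp: A_def B_def)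
    also have "\<dots> \<in> sets M" using Xu by (auto intro!: sets.Int measurable_sets)
    finally show ?thesis .
  qed
  \<comment> \<open>The Markov property speaks of histories of positive probability only; on the others both
    sides vanish.\<close>
  have AB: "prob (B x j) = prob (A x) * matrix_exp (u *\<^sub>R Q) $ x n $ j" for x j
  proof (cases "prob (A x) > 0")
    case True
    then have "\<P>(\<omega> in M. X (t n + u) \<omega> = j \<bar> \<forall>k\<le>n. X (t k) \<omega> = x k) = matrix_exp (u *\<^sub>R Q) $ x n $ j"
      using assms(2)[unfolded markov_chain_def, THEN conjunct2, THEN conjunct2, THEN spec[of _ n],
          THEN spec[of _ t], THEN spec[of _ x], THEN spec[of _ u], THEN spec[of _ j]] assms(3-5)
      by (simp add: A_def)
    with True show ?thesis
      by (simp add: cond_prob_def A_def B_def field_simps)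
  next
    case False
    moreover have "prob (B x j) \<le> prob (A x)"
      by (rule finite_measure_mono[OF _ A]) (auto simp: A_def B_def)
    ultimately show ?thesis
      using measure_nonneg[of M "A x"] measure_nonneg[of M "B x j"] by (simp add: not_less)
  qed
  let ?P = "PiE {..n} (\<lambda>_. UNIV :: 's set)"
  have fin: "finite ?P" by (intro finite_PiE) auto
  have single: "(\<Sum>x\<in>?P. indicator (A x) \<omega> *\<^sub>R H x) = H (\<lambda>k\<in>{..n}. X (t k) \<omega>)"
    if "\<omega> \<in> space M" for \<omega> and H :: "(nat \<Rightarrow> 's) \<Rightarrow> complex"
  proof -
    have "(\<Sum>x\<in>?P. indicator (A x) \<omega> *\<^sub>R H x) = (\<Sum>x\<in>?P. if x = (\<lambda>k\<in>{..n}. X (t k) \<omega>) then H x else 0)"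
    proof (intro sum.cong refl)
      fix x assume x: "x \<in> ?P"
      have "\<omega> \<in> A x \<longleftrightarrow> x = (\<lambda>k\<in>{..n}. X (t k) \<omega>)"
        using x that by (auto simp: A_def fun_eq_iff PiE_def extensional_def)
      then show "indicator (A x) \<omega> *\<^sub>R H x = (if x = (\<lambda>k\<in>{..n}. X (t k) \<omega>) then H x else 0)"
        by (auto simp: indicator_def)
    qed
    also have "\<dots> = H (\<lambda>k\<in>{..n}. X (t k) \<omega>)" using fin by (simp add: sum.delta)
    finally show ?thesis .
  qed
  have int: "integrable M (\<lambda>\<omega>. indicator S \<omega> *\<^sub>R c)"
    and val: "(\<integral>\<omega>. indicator S \<omega> *\<^sub>R c \<partial>M) = prob S *\<^sub>R c" if "S \<in> sets M" for S and c :: complex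
  proof -
    have "integrable M (indicator S :: _ \<Rightarrow> real)"
      using that by (intro integrable_real_indicator) (auto simp: emeasure_eq_measure)
    then show "integrable M (\<lambda>\<omega>. indicator S \<omega> *\<^sub>R c)" "(\<integral>\<omega>. indicator S \<omega> *\<^sub>R c \<partial>M) = prob S *\<^sub>R c"
      using that by simp_all
  qed
  have "(\<integral>\<omega>. F (\<lambda>k\<in>{..n}. X (t k) \<omega>) * (\<Sum>j\<in>UNIV. of_real (matrix_exp (u *\<^sub>R Q) $ X (t n) \<omega> $ j) * G j) \<partial>M)
    = (\<integral>\<omega>. (\<Sum>x\<in>?P. indicator (A x) \<omega> *\<^sub>R (F x * (\<Sum>j\<in>UNIV. of_real (matrix_exp (u *\<^sub>R Q) $ x n $ j) * G j))) \<partial>M)"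
    by (intro Bochner_Integration.integral_cong refl) (simp add: single)
  also have "\<dots> = (\<Sum>x\<in>?P. prob (A x) *\<^sub>R (F x * (\<Sum>j\<in>UNIV. of_real (matrix_exp (u *\<^sub>R Q) $ x n $ j) * G j)))"
    by (subst Bochner_Integration.integral_sum) (simp_all only: int[OF A] val[OF A])
  also have "\<dots> = (\<Sum>x\<in>?P. \<Sum>j\<in>UNIV. prob (B x j) *\<^sub>R (F x * G j))"
    by (simp add: AB scaleR_conv_of_real sum_distrib_left mult_ac)
  also have "\<dots> = (\<integral>\<omega>. (\<Sum>x\<in>?P. \<Sum>j\<in>UNIV. indicator (B x j) \<omega> *\<^sub>R (F x * G j)) \<partial>M)"
    by (simp only: Bochner_Integration.integral_sum Bochner_Integration.integrable_sum int[OF B] val[OF B])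
  also have "\<dots> = (\<integral>\<omega>. F (\<lambda>k\<in>{..n}. X (t k) \<omega>) * G (X (t n + u) \<omega>) \<partial>M)"
  proof (intro Bochner_Integration.integral_cong refl)
    fix \<omega> assume \<omega>: "\<omega> \<in> space M"
    have "(\<Sum>j\<in>UNIV. indicator (B x j) \<omega> *\<^sub>R (F x * G j)) = indicator (A x) \<omega> *\<^sub>R (F x * G (X (t n + u) \<omega>))" for x
    proof -
      have "(\<Sum>j\<in>UNIV. indicator (B x j) \<omega> *\<^sub>R (F x * G j)) =
        (\<Sum>j\<in>UNIV. if j = X (t n + u) \<omega> then indicator (A x) \<omega> *\<^sub>R (F x * G j) else 0)"
        using \<omega> by (intro sum.cong refl) (auto simp: A_def B_def indicator_def)
      then show ?thesis by simp
    qed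
    then show "(\<Sum>x\<in>?P. \<Sum>j\<in>UNIV. indicator (B x j) \<omega> *\<^sub>R (F x * G j)) = F (\<lambda>k\<in>{..n}. X (t k) \<omega>) * G (X (t n + u) \<omega>)"
      using single[OF \<omega>, of "\<lambda>x. F x * G (X (t n + u) \<omega>)"] by simp
  qed
  finally show ?thesis ..
qed

lemma telegraph_two_time_prob:
  fixes X :: "real \<Rightarrow> 'a \<Rightarrow> 2"
  assumes chain: "markov_chain M (telegraph_intensity lam) X"
    and "h \<ge> 0" and pos: "\<P>(\<omega> in M. X 0 \<omega> = i) > 0"
  shows "\<P>(\<omega> in M. X 0 \<omega> = i \<and> X h \<omega> = j) =
    \<P>(\<omega> in M. X 0 \<omega> = i) * (exp (- (lam * h)) * (if i = j then cosh (lam * h) else sinh (lam * h)))"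
proof -
  have "\<P>(\<omega> in M. X h \<omega> = j \<bar> X 0 \<omega> = i) = matrix_exp (h *\<^sub>R telegraph_intensity lam) $ i $ j"
    using chain[unfolded markov_chain_def, THEN conjunct2, THEN conjunct2, THEN spec[of _ 0],
        THEN spec[of _ "\<lambda>_. 0"], THEN spec[of _ "\<lambda>_. i"], THEN spec[of _ h], THEN spec[of _ j]] assms
    by simp
  with pos show ?thesis
    by (simp add: cond_prob_def matrix_exp_telegraph field_simps conj_commute split: if_splits)
qed

section \<open>Time integrals of right-constant paths\<close>

text \<open>A right-constant path may lack left limits, which is why the right ends of the grid cells are the
  sample points: they approach every \<open>s\<close> from the right, so the sampled values eventually equal
  \<open>f (X s)\<close>, and dominated convergence applies.\<close>

lemma riemann_sum_tendsto_lebesgue: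
  fixes X :: "real \<Rightarrow> 's" and f :: "'s \<Rightarrow> real"
  assumes h: "h > 0" and rc: "\<And>t. t \<ge> 0 \<Longrightarrow> \<forall>\<^sub>F s in at_right t. X s = X t"
    and bounded: "\<And>x. \<bar>f x\<bar> \<le> B"
  shows "(\<lambda>n. h / real n * (\<Sum>k=1..n. f (X (real k * (h / real n))))) \<longlonglongrightarrow> (LINT s:{0..h}|lborel. f (X s))"
proof -
  \<comment> \<open>The step function that takes on each grid cell the value at the right end of the cell.\<close>
  define g where "g n s = (\<Sum>k<n. indicator {real k * (h / real n)..<real (Suc k) * (h / real n)} s *\<^sub>R f (X (real (Suc k) * (h / real n))))" for n s
  have g_eq: "g n s = indicator {0..<h} s *\<^sub>R f (X ((of_int \<lfloor>s / (h / real n)\<rfloor> + 1) * (h / real n)))" if "n > 0" for n s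
  proof -
    define d where "d = h / real n"
    have d: "d > 0" "real n * d = h" using h that by (auto simp: d_def)
    define m where "m = \<lfloor>s / d\<rfloor>"
    have ind: "indicator {real k * d..<real (Suc k) * d} s = (if int k = m then 1 else 0 :: real)" for k
    proof -
      have "m = int k \<longleftrightarrow> real k * d \<le> s \<and> s < real (Suc k) * d"
        unfolding m_def floor_eq_iff using d by (simp add: field_simps)
      then show ?thesis by (auto simp: indicator_def)
    qed
    have "g n s = (\<Sum>k<n. if int k = m then f (X (real (Suc k) * d)) else 0)"
      unfolding g_def d_def[symmetric] ind by (intro sum.cong) auto
    also have "\<dots> = indicator {0..<h} s *\<^sub>R f (X ((of_int m + 1) * d))"
    proof (cases "0 \<le> m \<and> m < int n")
      case True
      then obtain k where k: "m = int k" "k < n" using nonneg_int_cases by (metis of_nat_less_iff)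
      have "real k * d \<le> s" "s < real (Suc k) * d"
        using ind[of k] k by (auto simp: indicator_def split: if_splits)
      moreover have "real (Suc k) * d \<le> real n * d" using k d by (intro mult_right_mono) auto
      moreover have "0 \<le> real k * d" using d by simp
      ultimately have "s \<in> {0..<h}" unfolding d(2) atLeastLessThan_iff by linarith
      moreover have "(\<Sum>i<n. if int i = m then f (X (real (Suc i) * d)) else 0) = (\<Sum>i<n. if i = k then f (X (real (Suc i) * d)) else 0)"
        using k by (intro sum.cong) auto
      ultimately show ?thesis using k by (simp add: add.commute)
    next
      case False
      have "s \<notin> {0..<h}"
      proof
        assume "s \<in> {0..<h}"
        then have "0 \<le> s / d" "s / d < real n" using d by (auto simp: field_simps)
        then show False using False unfolding m_def by (auto simp: floor_less_iff)
      qed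
      moreover have "(\<Sum>i<n. if int i = m then f (X (real (Suc i) * d)) else 0) = 0"
        using False by (intro sum.neutral) auto
      ultimately show ?thesis by simp
    qed
    finally show ?thesis unfolding d_def m_def .
  qed
  have lim: "(\<lambda>n. g n s) \<longlonglongrightarrow> indicator {0..<h} s *\<^sub>R f (X s)" for s
  proof (cases "s \<in> {0..<h}")
    case False
    then have "eventually (\<lambda>n. g n s = 0) sequentially"
      by (intro eventually_sequentiallyI[of 1]) (simp add: g_eq)
    with False show ?thesis by (auto intro: tendsto_eventually)
  next
    case True
    \<comment> \<open>The right end of the cell that contains \<open>s\<close>; it lies strictly to the right of \<open>s\<close>.\<close>
    define r where "r n = (of_int \<lfloor>s / (h / real n)\<rfloor> + 1) * (h / real n)" for n
    have r: "s < r n" "r n \<le> s + h / real n" if "n > 0" for n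
    proof -
      define d where "d = h / real n"
      have d: "d > 0" using h that by (simp add: d_def)
      have "of_int \<lfloor>s / d\<rfloor> * d \<le> s / d * d" "s / d * d < (of_int \<lfloor>s / d\<rfloor> + 1) * d"
        by (rule mult_right_mono[OF of_int_floor_le] mult_strict_right_mono[OF real_of_int_floor_add_one_gt]; use d in simp)+
      then show "s < r n" "r n \<le> s + h / real n"
        using d unfolding r_def d_def[symmetric] by (auto simp: distrib_right)
    qed
    have "filterlim r (at_right s) sequentially"
      unfolding filterlim_at
    proof
      show "\<forall>\<^sub>F n in sequentially. r n \<in> {s<..} \<and> r n \<noteq> s"
        using r(1) by (intro eventually_sequentiallyI[of 1]) (simp add: less_imp_neq[symmetric] order.strict_implies_not_eq)
    next
      have "(\<lambda>n. s + h / real n) \<longlonglongrightarrow> s + 0"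
        by (intro tendsto_intros lim_const_over_n)
      then show "r \<longlonglongrightarrow> s"
        by (intro tendsto_sandwich[of "\<lambda>_. s" r _ "\<lambda>n. s + h / real n"] eventually_sequentiallyI[of 1])
          (use r in \<open>auto intro: less_imp_le\<close>)
    qed
    then have "\<forall>\<^sub>F n in sequentially. X (r n) = X s"
      using rc[of s] True by (auto dest: eventually_compose_filterlim)
    then have "\<forall>\<^sub>F n in sequentially. g n s = indicator {0..<h} s *\<^sub>R f (X s)"
      using eventually_gt_at_top[of 0]
      by eventually_elim (use True in \<open>simp add: g_eq r_def\<close>)
    then show ?thesis by (rule tendsto_eventually)
  qed
  have meas[measurable]: "g n \<in> borel_measurable lborel" for n unfolding g_def by measurable
  have meas_lim[measurable]: "(\<lambda>s. indicator {0..<h} s *\<^sub>R f (X s)) \<in> borel_measurable lborel"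
    by (rule borel_measurable_LIMSEQ_real[OF lim]) simp
  have "B \<ge> 0" using bounded[of undefined] by linarith
  have conv: "(\<lambda>n. \<integral>s. g n s \<partial>lborel) \<longlonglongrightarrow> (\<integral>s. indicator {0..<h} s *\<^sub>R f (X s) \<partial>lborel)"
  proof (rule integral_dominated_convergence[where w = "\<lambda>s. indicator {0..<h} s *\<^sub>R B"])
    show "AE s in lborel. norm (g n s) \<le> indicator {0..<h} s *\<^sub>R B" for n
    proof (cases "n > 0")
      case True
      then show ?thesis using bounded by (intro AE_I2) (auto simp: g_eq indicator_def)
    qed (use \<open>B \<ge> 0\<close> in \<open>auto simp: g_def indicator_def\<close>)
    show "integrable lborel (\<lambda>s. indicator {0..<h} s *\<^sub>R B)"
      using h by (intro integrable_scaleR_left integrable_real_indicator) auto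
    show "AE s in lborel. (\<lambda>n. g n s) \<longlonglongrightarrow> indicator {0..<h} s *\<^sub>R f (X s)"
      using lim by simp
  qed (rule meas_lim meas)+
  have "(\<integral>s. g n s \<partial>lborel) = h / real n * (\<Sum>k=1..n. f (X (real k * (h / real n))))" for n
  proof -
    have len: "measure lborel {real k * (h / real n)..<real (Suc k) * (h / real n)} = h / real n" for k
    proof -
      have "real k * (h / real n) \<le> real (Suc k) * (h / real n)"
        using h by (intro mult_right_mono) auto
      then show ?thesis by (simp add: diff_divide_distrib[symmetric] left_diff_distrib[symmetric])
    qed
    have "(\<integral>s. g n s \<partial>lborel) = (\<Sum>k<n. measure lborel {real k * (h / real n)..<real (Suc k) * (h / real n)}
        * f (X (real (Suc k) * (h / real n))))"
    proof -
      have "integrable lborel (indicator {real k * (h / real n)..<real (Suc k) * (h / real n)} :: _ \<Rightarrow> real)" for k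
      proof (rule integrable_real_indicator)
        have "real k * (h / real n) \<le> real (Suc k) * (h / real n)"
          using h by (intro mult_right_mono) auto
        from emeasure_lborel_Ico[OF this]
        show "emeasure lborel {real k * (h / real n)..<real (Suc k) * (h / real n)} < \<infinity>"
          by (simp del: of_nat_Suc)
      qed simp
      then show ?thesis
        unfolding g_def by (subst Bochner_Integration.integral_sum) (simp_all del: of_nat_Suc measure_lborel_Ico)
    qed
    also have "\<dots> = (\<Sum>k<n. h / real n * f (X (real (Suc k) * (h / real n))))"
      unfolding len ..
    also have "\<dots> = h / real n * (\<Sum>k=1..n. f (X (real k * (h / real n))))"
      by (simp add: sum_distrib_left sum.atLeast1_atMost_eq)
    finally show ?thesis .
  qed
  moreover have "(\<integral>s. indicator {0..<h} s *\<^sub>R f (X s) \<partial>lborel) = (LINT s:{0..h}|lborel. f (X s))"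
    unfolding set_lebesgue_integral_def
  proof (rule integral_cong_AE)
    have "(\<lambda>s. indicator {0..h} s *\<^sub>R f (X s)) = (\<lambda>s. indicator {0..<h} s *\<^sub>R f (X s) + indicator {h} s *\<^sub>R f (X h))"
      using h by (auto simp: fun_eq_iff indicator_def)
    then show "(\<lambda>s. indicator {0..h} s *\<^sub>R f (X s)) \<in> borel_measurable lborel"
      by (simp only:) (intro borel_measurable_add meas_lim, simp)
    show "AE s in lborel. indicator {0..<h} s *\<^sub>R f (X s) = indicator {0..h} s *\<^sub>R f (X s)"
      using AE_lborel_singleton[of h] by eventually_elim (auto simp: indicator_def)
  qed (rule meas_lim)
  ultimately show ?thesis using conv by simp
qed

text \<open>Stated for an arbitrary \<open>\<sigma>\<close>-algebra because it is needed both for the given one and for the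
  one generated by the chain.\<close>

lemma time_integral_measurable:
  fixes X :: "real \<Rightarrow> 'a \<Rightarrow> 's::finite" and f :: "'s \<Rightarrow> real"
  assumes h: "h > 0" and X: "\<And>t. t \<ge> 0 \<Longrightarrow> X t \<in> measurable N (count_space UNIV)"
    and rc: "\<And>\<omega> t. \<omega> \<in> space N \<Longrightarrow> t \<ge> 0 \<Longrightarrow> \<forall>\<^sub>F s in at_right t. X s \<omega> = X t \<omega>"
  shows "(\<lambda>\<omega>. LINT s:{0..h}|lborel. f (X s \<omega>)) \<in> borel_measurable N"
proof (rule borel_measurable_LIMSEQ_metric)
  show "(\<lambda>\<omega>. h / real n * (\<Sum>k=1..n. f (X (real k * (h / real n)) \<omega>))) \<in> borel_measurable N" for n
    using h by (intro borel_measurable_times borel_measurable_sum borel_measurable_const measurable_compose[OF X]) auto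
  show "(\<lambda>n. h / real n * (\<Sum>k=1..n. f (X (real k * (h / real n)) \<omega>))) \<longlonglongrightarrow> (LINT s:{0..h}|lborel. f (X s \<omega>))"
    if "\<omega> \<in> space N" for \<omega>
    using rc[OF that] h
    by (intro riemann_sum_tendsto_lebesgue[where B = "\<Sum>x\<in>UNIV. \<bar>f x\<bar>"]) (auto intro: member_le_sum)
qed

text \<open>The Riemann sums satisfy this relation, and both sides are limits of Riemann sums.\<close>

lemma time_integral_affine:
  fixes X :: "real \<Rightarrow> 's::finite" and f g :: "'s \<Rightarrow> real"
  assumes h: "h > 0" and rc: "\<And>t. t \<ge> 0 \<Longrightarrow> \<forall>\<^sub>F s in at_right t. X s = X t"
    and fg: "\<And>x. f x = a + b * g x"
  shows "(LINT s:{0..h}|lborel. f (X s)) = a * h + b * (LINT s:{0..h}|lborel. g (X s))"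
proof (rule LIMSEQ_unique)
  have lim: "(\<lambda>n. h / real n * (\<Sum>k=1..n. f (X (real k * (h / real n))))) \<longlonglongrightarrow> (LINT s:{0..h}|lborel. f (X s))" for f :: "'s \<Rightarrow> real"
    using rc h by (intro riemann_sum_tendsto_lebesgue[where B = "\<Sum>x\<in>UNIV. \<bar>f x\<bar>"]) (auto intro: member_le_sum)
  show "(\<lambda>n. h / real n * (\<Sum>k=1..n. f (X (real k * (h / real n))))) \<longlonglongrightarrow> (LINT s:{0..h}|lborel. f (X s))"
    by (rule lim)
  have "(\<lambda>n. a * h + b * (h / real n * (\<Sum>k=1..n. g (X (real k * (h / real n)))))) \<longlonglongrightarrow> a * h + b * (LINT s:{0..h}|lborel. g (X s))"
    by (intro tendsto_intros lim)
  moreover have "\<forall>\<^sub>F n in sequentially. a * h + b * (h / real n * (\<Sum>k=1..n. g (X (real k * (h / real n))))) =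
      h / real n * (\<Sum>k=1..n. f (X (real k * (h / real n))))"
    using eventually_gt_at_top[of 0]
  proof eventually_elim
    case (elim n)
    have "(\<Sum>k=1..n. f (X (real k * (h / real n)))) = real n * a + b * (\<Sum>k=1..n. g (X (real k * (h / real n))))"
      by (simp add: fg sum.distrib sum_distrib_left)
    with elim show ?case by (simp add: field_simps)
  qed
  ultimately show "(\<lambda>n. h / real n * (\<Sum>k=1..n. f (X (real k * (h / real n))))) \<longlonglongrightarrow> a * h + b * (LINT s:{0..h}|lborel. g (X s))"
    by (rule Lim_transform_eventually)
qed

section \<open>Characteristic function of the time integral of the chain\<close>

lemma quadratic_bound:
  fixes f :: "real \<Rightarrow> 'a::real_normed_vector"
  assumes d: "d \<ge> 0"
    and f: "\<And>x. 0 \<le> x \<Longrightarrow> x \<le> d \<Longrightarrow> (f has_vector_derivative f' x) (at x)"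
    and f': "\<And>x. 0 \<le> x \<Longrightarrow> x \<le> d \<Longrightarrow> (f' has_vector_derivative f'' x) (at x)"
    and K: "\<And>x. 0 \<le> x \<Longrightarrow> x \<le> d \<Longrightarrow> norm (f'' x) \<le> K"
    and "f 0 = 0" "f' 0 = 0"
  shows "norm (f d) \<le> K * d\<^sup>2"
proof -
  have bound: "norm (f' x) \<le> K * d" if "x \<in> {0..d}" for x
  proof -
    have "norm (f' x - f' 0) \<le> K * norm (x - 0)"
    proof (rule differentiable_bound)
      show "(f' has_derivative (\<lambda>y. y *\<^sub>R f'' z)) (at z within {0..d})" if "z \<in> {0..d}" for z
        using f'[of z] that by (auto simp: has_vector_derivative_def intro: has_derivative_at_withinI)
      show "onorm (\<lambda>y. y *\<^sub>R f'' z) \<le> K" if "z \<in> {0..d}" for z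
        using K[of z] that by (simp add: onorm_scaleR_left[OF bounded_linear_ident] onorm_id)
    qed (use that d in auto)
    also have "\<dots> \<le> K * d"
      using that order_trans[OF norm_ge_zero K[of 0]] d by (intro mult_left_mono) auto
    finally show ?thesis using assms by simp
  qed
  have "norm (f d - f 0) \<le> (K * d) * norm (d - 0)"
  proof (rule differentiable_bound)
    show "(f has_derivative (\<lambda>y. y *\<^sub>R f' z)) (at z within {0..d})" if "z \<in> {0..d}" for z
      using f[of z] that by (auto simp: has_vector_derivative_def intro: has_derivative_at_withinI)
    show "onorm (\<lambda>y. y *\<^sub>R f' z) \<le> K * d" if "z \<in> {0..d}" for z
      using bound[of z] that by (simp add: onorm_scaleR_left[OF bounded_linear_ident] onorm_id)
  qed (use d in auto)
  then show ?thesis using assms by (simp add: power2_eq_square mult.assoc)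
qed

lemma norm_sum3_le:
  fixes a b c :: complex
  assumes "norm a \<le> x" "norm b \<le> x" "norm c \<le> y"
  shows "norm (a + b - c) \<le> 2 * x + y"
  using norm_triangle_ineq4[of "a + b" c] norm_triangle_ineq[of a b] assms by linarith

text \<open>Over one time step of length \<open>d\<close> the chain moves according to \<open>cosh (lam d)\<close> and
  \<open>sinh (lam d)\<close>, up to the factor \<open>exp (-lam d)\<close>, and then the phase \<open>\<plusminus>u d\<close> is collected. To first order in \<open>d\<close> this is the
  flow of the Kolmogorov equations, whence a quadratic error that is uniform on \<open>[0, h]\<close>.\<close>

lemma telegraph_step_error:
  assumes "lam > 0"
  obtains C where "C \<ge> 0"
    "\<And>s d. 0 \<le> s \<Longrightarrow> 0 \<le> d \<Longrightarrow> s + d \<le> h \<Longrightarrow>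
       norm (of_real (cosh (lam * d)) * iexp (u * d) * telegraph_diag u lam s
           + of_real (sinh (lam * d)) * iexp (- (u * d)) * telegraph_off u lam s
           - telegraph_diag u lam (s + d)) \<le> C * d\<^sup>2"
    "\<And>s d. 0 \<le> s \<Longrightarrow> 0 \<le> d \<Longrightarrow> s + d \<le> h \<Longrightarrow>
       norm (of_real (sinh (lam * d)) * iexp (u * d) * telegraph_diag u lam s
           + of_real (cosh (lam * d)) * iexp (- (u * d)) * telegraph_off u lam s
           - telegraph_off u lam (s + d)) \<le> C * d\<^sup>2"
proof -
  let ?p = "telegraph_diag u lam" and ?m = "telegraph_off u lam"
  have "continuous_on {0..h} ?p" "continuous_on {0..h} ?m"
    by (rule continuous_on_vector_derivative, rule has_vector_derivative_at_within,
        rule telegraph_diag_derivative telegraph_off_derivative)+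
  then have "bounded (?p ` {0..h})" "bounded (?m ` {0..h})"
    by (auto intro!: compact_imp_bounded compact_continuous_image)
  then obtain K1 K2 where K12: "\<And>t. t \<in> {0..h} \<Longrightarrow> norm (?p t) \<le> K1" "\<And>t. t \<in> {0..h} \<Longrightarrow> norm (?m t) \<le> K2"
    unfolding bounded_iff by blast
  define K where "K = max 0 (max K1 K2)"
  have K: "norm (?p t) \<le> K" "norm (?m t) \<le> K" if "0 \<le> t" "t \<le> h" for t
    using K12[of t] that by (auto simp: K_def)
  have "K \<ge> 0" by (simp add: K_def)
  define L where "L = (\<bar>u\<bar> + lam)\<^sup>2"
  have "L \<ge> 0" by (simp add: L_def)
  \<comment> \<open>In the exponentials \<open>exp (d (\<epsilon> lam + \<eta> \<i> u))\<close> with \<open>\<epsilon>, \<eta> = \<plusminus>1\<close> the one-step error has constant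
    coefficients, so differentiating it twice multiplies each summand by the square of its rate.\<close>
  define E where "E \<epsilon> \<eta> d = exp (d *\<^sub>R (of_real (\<epsilon> * lam) + \<i> * of_real (\<eta> * u)))" for \<epsilon> \<eta> d :: real
  define c where "c \<epsilon> \<eta> = of_real (\<epsilon> * lam) + \<i> * of_real (\<eta> * u)" for \<epsilon> \<eta> :: real
  have E: "(E \<epsilon> \<eta> has_vector_derivative c \<epsilon> \<eta> * E \<epsilon> \<eta> d) (at d)" for \<epsilon> \<eta> d
    using exp_scaleR_has_vector_derivative_right[of "c \<epsilon> \<eta>" d UNIV]
    unfolding E_def[abs_def] c_def by (simp add: mult.commute)
  have cosh: "of_real (cosh (lam * d)) * iexp (\<eta> * (u * d)) = (E 1 \<eta> d + E (-1) \<eta> d) / 2"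
    and sinh: "of_real (sinh (lam * d)) * iexp (\<eta> * (u * d)) = (E 1 \<eta> d - E (-1) \<eta> d) / 2" for d \<eta>
    unfolding E_def cosh_def sinh_def
    by (simp_all add: scaleR_conv_of_real exp_add[symmetric] exp_of_real[symmetric] field_simps)
  have cE: "norm (c \<epsilon> \<eta> * (c \<epsilon> \<eta> * E \<epsilon> \<eta> d)) \<le> L * exp (lam * h)"
    if "\<epsilon> \<in> {1, -1}" "\<eta> \<in> {1, -1}" "0 \<le> d" "d \<le> h" for \<epsilon> \<eta> d
  proof -
    have "norm (c \<epsilon> \<eta>) \<le> norm (of_real (\<epsilon> * lam) :: complex) + norm (\<i> * of_real (\<eta> * u))"
      unfolding c_def by (rule norm_triangle_ineq)
    also have "\<dots> = \<bar>u\<bar> + lam" using that assms by (auto simp: norm_mult)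
    finally have "norm (c \<epsilon> \<eta>) \<le> \<bar>u\<bar> + lam" .
    then have "norm (c \<epsilon> \<eta>) * norm (c \<epsilon> \<eta>) \<le> L"
      unfolding L_def power2_eq_square using assms by (intro mult_mono) auto
    moreover have "norm (E \<epsilon> \<eta> d) \<le> exp (lam * h)"
    proof -
      have "d * (\<epsilon> * lam) \<le> lam * h"
      proof -
        have "0 \<le> d * lam" "d * lam \<le> h * lam" using that assms by (auto intro: mult_right_mono)
        then show ?thesis using that(1) by (auto simp: mult.commute[of lam h])
      qed
      then show ?thesis unfolding E_def by (simp add: norm_exp_eq_Re)
    qed
    ultimately show ?thesis
      unfolding norm_mult mult.assoc[symmetric] using \<open>L \<ge> 0\<close> by (intro mult_mono) auto
  qed
  have cst: "norm (of_real (lam\<^sup>2 - u\<^sup>2) :: complex) \<le> L"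
  proof -
    have "\<bar>lam\<^sup>2 - u\<^sup>2\<bar> \<le> L"
      unfolding L_def abs_le_iff using assms by (auto simp: power2_sum)
    then show ?thesis by (simp only: norm_of_real)
  qed
  define C where "C = 2 * (L * exp (lam * h) * K) + L * K"
  have "C \<ge> 0" using \<open>L \<ge> 0\<close> \<open>K \<ge> 0\<close> by (simp add: C_def)
  \<comment> \<open>\<open>\<epsilon> = 1\<close> is the start in the target state and \<open>\<epsilon> = -1\<close> the start in the other one.\<close>
  have main: "norm ((E 1 1 d + \<epsilon> * E (-1) 1 d) / 2 * ?p s + (E 1 (-1) d - \<epsilon> * E (-1) (-1) d) / 2 * ?m s - g (s + d)) \<le> C * d\<^sup>2"
    if sd: "0 \<le> s" "0 \<le> d" "s + d \<le> h" and \<epsilon>: "\<epsilon> = 1 \<and> g = ?p \<or> \<epsilon> = - 1 \<and> g = ?m" for s d :: real and \<epsilon> :: complex and g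
  proof -
    \<comment> \<open>The derivative of \<open>g\<close> by the differential equations; as the matrix of that system squares to
      \<open>lam\<^sup>2 - u\<^sup>2\<close> times the identity, the second derivative is a multiple of \<open>g\<close> itself.\<close>
    define g' where "g' t = (if \<epsilon> = 1 then \<i> * of_real u * ?p t + of_real lam * ?m t else of_real lam * ?p t - \<i> * of_real u * ?m t)" for t
    have g: "(g has_vector_derivative g' t) (at t)" for t
      using \<epsilon> telegraph_diag_derivative[of u lam t] telegraph_off_derivative[of u lam t]
      by (auto simp: g'_def)
    have g': "(g' has_vector_derivative of_real (lam\<^sup>2 - u\<^sup>2) * g t) (at t)" for t
      using \<epsilon> unfolding g'_def[abs_def]
      by (auto intro!: derivative_eq_intros telegraph_diag_derivative telegraph_off_derivative
          simp: algebra_simps power2_eq_square)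
    have shift: "((\<lambda>x. f (s + x)) has_vector_derivative f' (s + x)) (at x)"
      if "\<And>t. (f has_vector_derivative f' t) (at t)" for f f' :: "real \<Rightarrow> complex" and x
    proof -
      have "((\<lambda>x. s + x) has_vector_derivative 0 + 1) (at x)"
        by (intro has_vector_derivative_add has_vector_derivative_const has_vector_derivative_id)
      from vector_diff_chain_at[OF this that] show ?thesis by (simp add: o_def)
    qed
    have g_bound: "norm (g t) \<le> K" if "0 \<le> t" "t \<le> h" for t
      using \<epsilon> K[OF that] by auto
    have \<epsilon>1: "norm \<epsilon> = 1" using \<epsilon> by auto
    show ?thesis
    proof (rule quadratic_bound[OF sd(2)])
      fix x assume x: "0 \<le> x" "x \<le> d"
      show "((\<lambda>d. (E 1 1 d + \<epsilon> * E (-1) 1 d) / 2 * ?p s + (E 1 (-1) d - \<epsilon> * E (-1) (-1) d) / 2 * ?m s - g (s + d))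
        has_vector_derivative
         (c 1 1 * E 1 1 x + \<epsilon> * (c (-1) 1 * E (-1) 1 x)) / 2 * ?p s
         + (c 1 (-1) * E 1 (-1) x - \<epsilon> * (c (-1) (-1) * E (-1) (-1) x)) / 2 * ?m s - g' (s + x)) (at x)"
        unfolding divide_inverse by (auto intro!: derivative_eq_intros E shift g)
      show "((\<lambda>x. (c 1 1 * E 1 1 x + \<epsilon> * (c (-1) 1 * E (-1) 1 x)) / 2 * ?p s
         + (c 1 (-1) * E 1 (-1) x - \<epsilon> * (c (-1) (-1) * E (-1) (-1) x)) / 2 * ?m s - g' (s + x)) has_vector_derivative
         (c 1 1 * (c 1 1 * E 1 1 x) + \<epsilon> * (c (-1) 1 * (c (-1) 1 * E (-1) 1 x))) / 2 * ?p s
         + (c 1 (-1) * (c 1 (-1) * E 1 (-1) x) - \<epsilon> * (c (-1) (-1) * (c (-1) (-1) * E (-1) (-1) x))) / 2 * ?m s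
          - of_real (lam\<^sup>2 - u\<^sup>2) * g (s + x)) (at x)"
        unfolding divide_inverse by (auto intro!: derivative_eq_intros E shift[OF g', unfolded of_real_diff])
      have half: "norm ((a + b) / 2 * z) \<le> L * exp (lam * h) * K"
        if "norm a \<le> L * exp (lam * h)" "norm b \<le> L * exp (lam * h)" "norm z \<le> K" for a b z :: complex
      proof -
        have "norm ((a + b) / 2) \<le> L * exp (lam * h)"
          using norm_triangle_ineq[of a b] that by (simp add: norm_divide)
        then show ?thesis
          unfolding norm_mult using that \<open>L \<ge> 0\<close> by (intro mult_mono) auto
      qed
      have "norm ((c 1 1 * (c 1 1 * E 1 1 x) + \<epsilon> * (c (-1) 1 * (c (-1) 1 * E (-1) 1 x))) / 2 * ?p s) \<le> L * exp (lam * h) * K"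
        using cE[of 1 1 x] cE[of "-1" 1 x] x sd K[of s] \<epsilon>1 by (intro half) (auto simp: norm_mult)
      moreover have "norm ((c 1 (-1) * (c 1 (-1) * E 1 (-1) x) - \<epsilon> * (c (-1) (-1) * (c (-1) (-1) * E (-1) (-1) x))) / 2 * ?m s) \<le> L * exp (lam * h) * K"
        unfolding diff_conv_add_uminus
        using cE[of 1 "-1" x] cE[of "-1" "-1" x] x sd K[of s] \<epsilon>1 by (intro half) (auto simp: norm_mult)
      moreover have "norm (of_real (lam\<^sup>2 - u\<^sup>2) * g (s + x)) \<le> L * K"
        unfolding norm_mult using cst g_bound[of "s + x"] x sd \<open>L \<ge> 0\<close> by (intro mult_mono) auto
      ultimately show "norm ((c 1 1 * (c 1 1 * E 1 1 x) + \<epsilon> * (c (-1) 1 * (c (-1) 1 * E (-1) 1 x))) / 2 * ?p s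
         + (c 1 (-1) * (c 1 (-1) * E 1 (-1) x) - \<epsilon> * (c (-1) (-1) * (c (-1) (-1) * E (-1) (-1) x))) / 2 * ?m s
          - of_real (lam\<^sup>2 - u\<^sup>2) * g (s + x)) \<le> C"
        unfolding C_def by (rule norm_sum3_le)
    next
      show "(E 1 1 0 + \<epsilon> * E (-1) 1 0) / 2 * ?p s + (E 1 (-1) 0 - \<epsilon> * E (-1) (-1) 0) / 2 * ?m s - g (s + 0) = 0"
        using \<epsilon> by (auto simp: E_def)
      show "(c 1 1 * E 1 1 0 + \<epsilon> * (c (-1) 1 * E (-1) 1 0)) / 2 * ?p s
         + (c 1 (-1) * E 1 (-1) 0 - \<epsilon> * (c (-1) (-1) * E (-1) (-1) 0)) / 2 * ?m s - g' (s + 0) = 0"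
        using \<epsilon> by (auto simp: E_def c_def g'_def)
    qed
  qed
  show ?thesis
  proof (rule that[OF \<open>C \<ge> 0\<close>])
    fix s d :: real assume sd: "0 \<le> s" "0 \<le> d" "s + d \<le> h"
    show "norm (of_real (cosh (lam * d)) * iexp (u * d) * ?p s
           + of_real (sinh (lam * d)) * iexp (- (u * d)) * ?m s - ?p (s + d)) \<le> C * d\<^sup>2"
      unfolding cosh[of d 1, unfolded mult_1] sinh[of d "-1", unfolded mult_minus1]
      using main[OF sd, of 1 ?p] by simp
    show "norm (of_real (sinh (lam * d)) * iexp (u * d) * ?p s
           + of_real (cosh (lam * d)) * iexp (- (u * d)) * ?m s - ?m (s + d)) \<le> C * d\<^sup>2"
      unfolding sinh[of d 1, unfolded mult_1] cosh[of d "-1", unfolded mult_minus1]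
      using main[OF sd, of "-1" ?m] by simp
  qed
qed

text \<open>The expectation is approximated by sampling the path on a grid with \<open>n\<close> cells. Replacing the
  remaining expectation by its asserted value cell by cell costs \<open>C (h/n)\<^sup>2\<close> per cell by the Markov
  property and \<open>telegraph_step_error\<close>, hence \<open>O(1/n)\<close> in total. The sampled
  integrals converge along every path, so dominated convergence gives the claim.\<close>

lemma telegraph_char:
  fixes X :: "real \<Rightarrow> 'a \<Rightarrow> 2"
  assumes "prob_space M" "lam > 0" "h > 0" and chain: "markov_chain M (telegraph_intensity lam) X"
  shows "(\<integral>\<omega>. of_bool (X 0 \<omega> = k) * iexp (u * (LINT s:{0..h}|lborel. telegraph_sign j (X s \<omega>))) * of_bool (X h \<omega> = j) \<partial>M)
    = of_real (\<P>(\<omega> in M. X 0 \<omega> = k)) * (of_real (exp (- (lam * h))) *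
       (if k = j then telegraph_diag u lam h else telegraph_off u lam h))"
proof -
  interpret prob_space M by fact
  let ?\<xi> = "telegraph_sign j"
  have X[measurable]: "X s \<in> measurable M (count_space UNIV)" if "0 \<le> s" for s
    using chain that by (auto simp: markov_chain_def)
  have rc: "\<forall>\<^sub>F s in at_right t. X s \<omega> = X t \<omega>" if "\<omega> \<in> space M" "t \<ge> 0" for \<omega> t
    using chain that by (auto simp: markov_chain_def)
  \<comment> \<open>The asserted value of the functional over a time span \<open>t\<close> for the start in \<open>x\<close>.\<close>
  define v where "v t x = of_real (exp (- (lam * t))) * (if x = j then telegraph_diag u lam t else telegraph_off u lam t)" for t and x :: 2
  obtain C where "C \<ge> 0"
    and C1: "\<And>s d. 0 \<le> s \<Longrightarrow> 0 \<le> d \<Longrightarrow> s + d \<le> h \<Longrightarrow>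
       norm (of_real (cosh (lam * d)) * iexp (u * d) * telegraph_diag u lam s
           + of_real (sinh (lam * d)) * iexp (- (u * d)) * telegraph_off u lam s
           - telegraph_diag u lam (s + d)) \<le> C * d\<^sup>2"
    and C2: "\<And>s d. 0 \<le> s \<Longrightarrow> 0 \<le> d \<Longrightarrow> s + d \<le> h \<Longrightarrow>
       norm (of_real (sinh (lam * d)) * iexp (u * d) * telegraph_diag u lam s
           + of_real (cosh (lam * d)) * iexp (- (u * d)) * telegraph_off u lam s
           - telegraph_off u lam (s + d)) \<le> C * d\<^sup>2"
    using telegraph_step_error[OF \<open>lam > 0\<close>, of h u] by metis
  have step: "norm ((\<Sum>y\<in>UNIV. of_real (matrix_exp (d *\<^sub>R telegraph_intensity lam) $ x $ y) * (iexp (u * (d * ?\<xi> y)) * v s y)) - v (s + d) x) \<le> C * d\<^sup>2"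
    if sd: "0 \<le> s" "0 \<le> d" "s + d \<le> h" for s d x
  proof -
    have two: "(\<Sum>y\<in>UNIV. f y) = f j + f (if j = 1 then 2 else 1)" for f :: "2 \<Rightarrow> complex"
      using exhaust_2[of j] by (auto simp: sum_2)
    have oj: "(if j = 1 then 2 else 1) \<noteq> j" and ox: "x \<noteq> j \<Longrightarrow> x = (if j = 1 then 2 else 1)"
      using exhaust_2[of j] exhaust_2[of x] by auto
    define P where "P = telegraph_diag u lam s"
    define Q where "Q = telegraph_off u lam s"
    define e where "e = complex_of_real (exp (- (lam * (s + d))))"
    have e: "of_real (exp (- (lam * d))) * (c1 * (c2 * (of_real (exp (- (lam * s))) * c3))) = e * (c1 * c2 * c3)" for c1 c2 c3
    proof -
      have "e = of_real (exp (- (lam * d))) * of_real (exp (- (lam * s)))"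
        unfolding e_def of_real_mult[symmetric] exp_add[symmetric] by (simp add: algebra_simps)
      then show ?thesis by simp
    qed
    have "(\<Sum>y\<in>UNIV. of_real (matrix_exp (d *\<^sub>R telegraph_intensity lam) $ x $ y) * (iexp (u * (d * ?\<xi> y)) * v s y)) - v (s + d) x
      = e * ((if x = j then of_real (cosh (lam * d)) * iexp (u * d) * P + of_real (sinh (lam * d)) * iexp (- (u * d)) * Q
          else of_real (sinh (lam * d)) * iexp (u * d) * P + of_real (cosh (lam * d)) * iexp (- (u * d)) * Q)
         - (if x = j then telegraph_diag u lam (s + d) else telegraph_off u lam (s + d)))"
      unfolding two matrix_exp_telegraph v_def P_def[symmetric] Q_def[symmetric] e_def[symmetric] of_real_mult mult.assoc e
      using oj ox by (auto simp: right_diff_distrib distrib_left mult.assoc)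
    also have "norm \<dots> \<le> 1 * (C * d\<^sup>2)"
      unfolding norm_mult
    proof (rule mult_mono)
      show "norm e \<le> 1" unfolding e_def norm_of_real using sd \<open>lam > 0\<close> by simp
    qed (use C1[OF sd] C2[OF sd] in \<open>auto simp: P_def Q_def\<close>)
    finally show ?thesis by simp
  qed
  \<comment> \<open>The exact expectation of the discretised functional; it converges to both sides of the claim.\<close>
  define S where "S n \<omega> = h / real n * (\<Sum>k=1..n. ?\<xi> (X (real k * (h / real n)) \<omega>))" for n \<omega>
  define I where "I n = (\<integral>\<omega>. of_bool (X 0 \<omega> = k) * iexp (u * S n \<omega>) * of_bool (X h \<omega> = j) \<partial>M)" for n
  have I: "norm (I n - of_real (\<P>(\<omega> in M. X 0 \<omega> = k)) * v h k) \<le> C * h\<^sup>2 / real n" if "n > 0" for n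
  proof -
    define d where "d = h / real n"
    have d: "d > 0" "real n * d = h" using \<open>h > 0\<close> that by (auto simp: d_def)
    define \<Phi> where "\<Phi> m p = of_bool (p 0 = k) * (\<Prod>i=1..m. iexp (u * (d * ?\<xi> (p i))))" for m and p :: "nat \<Rightarrow> 2"
    define path where "path m \<omega> = (\<lambda>i\<in>{..m}. X (real i * d) \<omega>)" for m \<omega>
    \<comment> \<open>The functional is used exactly on the first \<open>m\<close> grid cells and replaced by \<open>v\<close> on the
      remaining time, so that \<open>U n\<close> is the discrete expectation and \<open>U 0\<close> the asserted value.\<close>
    define U where "U m = (\<integral>\<omega>. \<Phi> m (path m \<omega>) * v (h - real m * d) (X (real m * d) \<omega>) \<partial>M)" for m
    have \<Phi>_path: "\<Phi> m (path m \<omega>) = of_bool (X 0 \<omega> = k) * (\<Prod>i=1..m. iexp (u * (d * ?\<xi> (X (real i * d) \<omega>))))" for m \<omega>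
      unfolding \<Phi>_def path_def by (intro arg_cong2[where f = "(*)"] prod.cong) auto
    have \<Phi>_norm: "norm (\<Phi> m p) \<le> 1" for m p
      unfolding \<Phi>_def norm_mult by (simp add: prod_norm[symmetric])
    have meas[measurable]: "(\<lambda>\<omega>. f (X (real i * d) \<omega>)) \<in> borel_measurable M" for i and f :: "2 \<Rightarrow> complex"
      using measurable_compose[OF X[of "real i * d"], of f borel] d by simp
    have meas0[measurable]: "(\<lambda>\<omega>. f (X 0 \<omega>)) \<in> borel_measurable M" for f :: "2 \<Rightarrow> complex"
      using measurable_compose[OF X[of 0], of f borel] by simp
    have \<Phi>_meas[measurable]: "(\<lambda>\<omega>. \<Phi> m (path m \<omega>)) \<in> borel_measurable M" for m
      unfolding \<Phi>_path
      by (intro borel_measurable_times borel_measurable_prod meas meas0)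
    have integrable: "integrable M (\<lambda>\<omega>. \<Phi> m (path m \<omega>) * f (X (real i * d) \<omega>))" for m i and f :: "2 \<Rightarrow> complex"
    proof (rule integrable_const_bound)
      show "AE \<omega> in M. norm (\<Phi> m (path m \<omega>) * f (X (real i * d) \<omega>)) \<le> 1 * (\<Sum>x\<in>UNIV. norm (f x))"
        unfolding norm_mult by (intro AE_I2 mult_mono \<Phi>_norm member_le_sum) auto
    qed (intro borel_measurable_times \<Phi>_meas meas)
    have diff: "norm (U (Suc m) - U m) \<le> C * d\<^sup>2" if "m < n" for m
    proof -
      define s where "s = h - real (Suc m) * d"
      have s: "0 \<le> s" "s + d \<le> h" "s + d = h - real m * d"
      proof -
        have "real (Suc m) * d \<le> real n * d" using that d by (intro mult_right_mono) auto
        then show "0 \<le> s" by (simp add: s_def d)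
      qed (use d in \<open>auto simp: s_def algebra_simps\<close>)
      define g where "g y = iexp (u * (d * ?\<xi> y)) * v s y" for y
      have "U (Suc m) = (\<integral>\<omega>. \<Phi> m (path m \<omega>) * g (X (real m * d + d) \<omega>) \<partial>M)"
        unfolding U_def \<Phi>_path g_def s_def[symmetric]
        by (simp add: algebra_simps)
      also have "\<dots> = (\<integral>\<omega>. \<Phi> m (path m \<omega>) * (\<Sum>y\<in>UNIV. of_real (matrix_exp (d *\<^sub>R telegraph_intensity lam) $ X (real m * d) \<omega> $ y) * g y) \<partial>M)"
        unfolding path_def
        by (rule markov_chain_expectation[OF \<open>prob_space M\<close> chain, where t = "\<lambda>i. real i * d"])
          (use d in auto)
      finally have "U (Suc m) - U m = (\<integral>\<omega>. \<Phi> m (path m \<omega>) * ((\<Sum>y\<in>UNIV. of_real (matrix_exp (d *\<^sub>R telegraph_intensity lam) $ X (real m * d) \<omega> $ y) * g y) - v (s + d) (X (real m * d) \<omega>)) \<partial>M)"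
        unfolding U_def s(3)[symmetric] right_diff_distrib
        by (subst Bochner_Integration.integral_diff)
          (auto intro: integrable[of _ "\<lambda>x. \<Sum>y\<in>UNIV. of_real (matrix_exp (d *\<^sub>R telegraph_intensity lam) $ x $ y) * g y"] integrable)
      also have "norm \<dots> \<le> (\<integral>\<omega>. C * d\<^sup>2 \<partial>M)"
      proof (rule order_trans[OF integral_norm_bound], rule integral_mono)
        show "integrable M (\<lambda>\<omega>. norm (\<Phi> m (path m \<omega>) * ((\<Sum>y\<in>UNIV. of_real (matrix_exp (d *\<^sub>R telegraph_intensity lam) $ X (real m * d) \<omega> $ y) * g y) - v (s + d) (X (real m * d) \<omega>))))"
          by (rule integrable_norm, rule integrable[of _ "\<lambda>x. (\<Sum>y\<in>UNIV. of_real (matrix_exp (d *\<^sub>R telegraph_intensity lam) $ x $ y) * g y) - v (s + d) x"])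
        fix \<omega>
        have "norm (\<Phi> m (path m \<omega>) * ((\<Sum>y\<in>UNIV. of_real (matrix_exp (d *\<^sub>R telegraph_intensity lam) $ X (real m * d) \<omega> $ y) * g y) - v (s + d) (X (real m * d) \<omega>)))
          \<le> 1 * (C * d\<^sup>2)"
          unfolding norm_mult g_def using d s by (intro mult_mono \<Phi>_norm step) auto
        then show "norm (\<Phi> m (path m \<omega>) * ((\<Sum>y\<in>UNIV. of_real (matrix_exp (d *\<^sub>R telegraph_intensity lam) $ X (real m * d) \<omega> $ y) * g y) - v (s + d) (X (real m * d) \<omega>)))
          \<le> C * d\<^sup>2" by simp
      qed simp
      finally show ?thesis by (simp add: prob_space)
    qed
    have "norm (U n - U 0) = norm (\<Sum>m<n. U (Suc m) - U m)"
      by (simp add: sum_lessThan_telescope)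
    also have "\<dots> \<le> (\<Sum>m<n. C * d\<^sup>2)"
      by (intro sum_norm_le diff) simp
    also have "\<dots> = C * h\<^sup>2 / real n"
      using that by (simp add: d_def power2_eq_square)
    finally have "norm (U n - U 0) \<le> C * h\<^sup>2 / real n" .
    moreover have "U 0 = of_real (\<P>(\<omega> in M. X 0 \<omega> = k)) * v h k"
    proof -
      have "U 0 = (\<integral>\<omega>. indicator {\<omega>\<in>space M. X 0 \<omega> = k} \<omega> *\<^sub>R v h k \<partial>M)"
        unfolding U_def \<Phi>_path by (intro Bochner_Integration.integral_cong) (auto simp: indicator_def)
      also have "\<dots> = of_real (\<P>(\<omega> in M. X 0 \<omega> = k)) * v h k"
      proof -
        have "{\<omega>\<in>space M. X 0 \<omega> = k} \<in> sets M"
          using measurable_sets[OF X[of 0], of "{k}"] by (simp add: vimage_def Int_def conj_commute)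
        then show ?thesis by (simp add: scaleR_conv_of_real)
      qed
      finally show ?thesis .
    qed
    moreover have "U n = I n"
    proof -
      have "(\<Prod>i=1..n. iexp (u * (d * ?\<xi> (X (real i * d) \<omega>)))) = iexp (u * S n \<omega>)" for \<omega>
        unfolding S_def d_def[symmetric] exp_sum[OF finite_atLeastAtMost, symmetric]
        by (simp only: sum_distrib_left of_real_sum)
      then show ?thesis
        unfolding U_def I_def \<Phi>_path
        by (intro Bochner_Integration.integral_cong) (auto simp: d v_def)
    qed
    ultimately show ?thesis by simp
  qed
  have "I \<longlonglongrightarrow> of_real (\<P>(\<omega> in M. X 0 \<omega> = k)) * v h k"
  proof (rule LIM_zero_cancel, rule Lim_null_comparison)
    show "\<forall>\<^sub>F n in sequentially. norm (I n - of_real (\<P>(\<omega> in M. X 0 \<omega> = k)) * v h k) \<le> C * h\<^sup>2 / real n"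
      using I by (intro eventually_sequentiallyI[of 1]) auto
  qed (rule lim_const_over_n)
  moreover have "I \<longlonglongrightarrow> (\<integral>\<omega>. of_bool (X 0 \<omega> = k) * iexp (u * (LINT s:{0..h}|lborel. ?\<xi> (X s \<omega>))) * of_bool (X h \<omega> = j) \<partial>M)"
    unfolding I_def
  proof (rule integral_dominated_convergence[where w = "\<lambda>_. 1"])
    have S_meas: "S n \<in> borel_measurable M" for n
      unfolding S_def using \<open>h > 0\<close>
      by (intro borel_measurable_times borel_measurable_sum borel_measurable_const measurable_compose[OF X]) auto
    have S_lim: "(\<lambda>n. S n \<omega>) \<longlonglongrightarrow> (LINT s:{0..h}|lborel. ?\<xi> (X s \<omega>))" if "\<omega> \<in> space M" for \<omega>
      unfolding S_def using rc[OF that] \<open>h > 0\<close>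
      by (intro riemann_sum_tendsto_lebesgue[where B = 1]) auto
    have ind: "(\<lambda>\<omega>. of_bool (X t \<omega> = i) :: complex) \<in> borel_measurable M" if "t \<ge> 0" for t i
      by (rule measurable_compose[OF X[OF that], of "\<lambda>x. of_bool (x = i)"]) simp
    have lim_meas: "(\<lambda>\<omega>. LINT s:{0..h}|lborel. ?\<xi> (X s \<omega>)) \<in> borel_measurable M"
      by (rule time_integral_measurable[OF \<open>h > 0\<close> X rc])
    show "(\<lambda>\<omega>. of_bool (X 0 \<omega> = k) * iexp (u * (LINT s:{0..h}|lborel. ?\<xi> (X s \<omega>))) * of_bool (X h \<omega> = j)) \<in> borel_measurable M"
      using \<open>h > 0\<close> lim_meas by (intro borel_measurable_times ind) (auto)
    show "(\<lambda>\<omega>. of_bool (X 0 \<omega> = k) * iexp (u * S n \<omega>) * of_bool (X h \<omega> = j)) \<in> borel_measurable M" for n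
      using \<open>h > 0\<close> S_meas[of n] by (intro borel_measurable_times ind) (auto)
    show "AE \<omega> in M. (\<lambda>n. of_bool (X 0 \<omega> = k) * iexp (u * S n \<omega>) * of_bool (X h \<omega> = j)) \<longlonglongrightarrow>
        of_bool (X 0 \<omega> = k) * iexp (u * (LINT s:{0..h}|lborel. ?\<xi> (X s \<omega>))) * of_bool (X h \<omega> = j)"
      using S_lim by (intro AE_I2 tendsto_intros)
    show "AE \<omega> in M. norm (of_bool (X 0 \<omega> = k) * iexp (u * S n \<omega>) * of_bool (X h \<omega> = j)) \<le> 1" for n
      by (intro AE_I2) (auto simp: norm_mult)
  qed simp
  ultimately show ?thesis
    unfolding v_def using LIMSEQ_unique by blast
qed

text \<open>The previous lemma counts the end state with sign \<open>+1\<close>. If the start state is to get that sign and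
  the end state differs, the time integral changes sign, which leaves the even function
  \<open>u \<mapsto> telegraph_off u lam h\<close> unchanged.\<close>

lemma telegraph_char_from_start:
  fixes X :: "real \<Rightarrow> 'a \<Rightarrow> 2"
  assumes M: "prob_space M" and lam: "lam > 0" and h: "h > 0"
    and chain: "markov_chain M (telegraph_intensity lam) X"
  shows "(\<integral>\<omega>. of_bool (X 0 \<omega> = i \<and> X h \<omega> = j) * iexp (v * (LINT s:{0..h}|lborel. telegraph_sign i (X s \<omega>))) \<partial>M)
    = of_real (\<P>(\<omega> in M. X 0 \<omega> = i)) * (of_real (exp (- (lam * h))) *
       (if i = j then telegraph_diag v lam h else telegraph_off v lam h))"
proof (cases "i = j")
  case True
  then show ?thesis
    using telegraph_char[OF M lam h chain, where k = i and j = j and u = v]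
    by (simp add: of_bool_conj mult_ac)
next
  case False
  have flip: "(LINT s:{0..h}|lborel. telegraph_sign i (X s \<omega>)) = 0 * h + (-1) * (LINT s:{0..h}|lborel. telegraph_sign j (X s \<omega>))"
    if "\<omega> \<in> space M" for \<omega>
  proof (rule time_integral_affine[OF h])
    show "\<forall>\<^sub>F s in at_right t. X s \<omega> = X t \<omega>" if "t \<ge> 0" for t
      using chain \<open>\<omega> \<in> space M\<close> that by (auto simp: markov_chain_def)
    show "telegraph_sign i x = 0 + (-1) * telegraph_sign j x" for x
      using False exhaust_2[of x] exhaust_2[of i] exhaust_2[of j] by auto
  qed
  have "(\<integral>\<omega>. of_bool (X 0 \<omega> = i \<and> X h \<omega> = j) * iexp (v * (LINT s:{0..h}|lborel. telegraph_sign i (X s \<omega>))) \<partial>M)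
    = (\<integral>\<omega>. of_bool (X 0 \<omega> = i) * iexp (- v * (LINT s:{0..h}|lborel. telegraph_sign j (X s \<omega>))) * of_bool (X h \<omega> = j) \<partial>M)"
    by (intro Bochner_Integration.integral_cong refl) (simp add: flip of_bool_conj mult_ac)
  also have "\<dots> = of_real (\<P>(\<omega> in M. X 0 \<omega> = i)) * (of_real (exp (- (lam * h))) * telegraph_off v lam h)"
    using telegraph_char[OF M lam h chain, where k = i and j = j and u = "- v"] False
    by (simp add: telegraph_off_uminus)
  finally show ?thesis using False by simp
qed

section \<open>Conditional densities from characteristic functions\<close>

text \<open>Levy's uniqueness theorem, applied to the law of \<open>Z\<close> under the conditional measure.\<close>

lemma has_cond_density_charI:
  assumes M: "prob_space M" and Z: "Z \<in> borel_measurable M"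
    and E: "{\<omega>\<in>space M. P \<omega>} \<in> sets M" "\<P>(\<omega> in M. P \<omega>) > 0"
    and g: "\<And>z. 0 \<le> g z" "integrable lborel g"
    and char: "\<And>u. (\<integral>\<omega>. of_bool (P \<omega>) * iexp (u * Z \<omega>) \<partial>M) =
      of_real (\<P>(\<omega> in M. P \<omega>)) * (\<integral>z. of_real (g z) * iexp (u * z) \<partial>lborel)"
  shows "has_cond_density M P Z g"
proof -
  interpret prob_space M by fact
  define A where "A = {\<omega>\<in>space M. P \<omega>}"
  define N where "N = uniform_measure M A"
  have A: "A \<in> sets M" "prob A > 0" "emeasure M A \<noteq> 0" "emeasure M A \<noteq> \<infinity>"
    using E by (simp_all add: A_def emeasure_eq_measure)
  interpret N: prob_space N unfolding N_def using A(3,4) by (rule prob_space_uniform_measure)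
  have ZN[measurable]: "Z \<in> borel_measurable N" using Z by (simp add: N_def)
  have [measurable]: "g \<in> borel_measurable borel" using g(2) by auto
  have N_density: "N = density M (\<lambda>\<omega>. ennreal (indicator A \<omega> / prob A))"
    unfolding N_def uniform_measure_def
    using A by (intro arg_cong2[where f = density] ext)
      (auto simp: emeasure_eq_measure divide_ennreal[symmetric] ennreal_indicator)
  have char_N: "(\<integral>\<omega>. iexp (u * Z \<omega>) \<partial>N) = (\<integral>z. of_real (g z) * iexp (u * z) \<partial>lborel)" for u
  proof -
    have "(\<integral>\<omega>. iexp (u * Z \<omega>) \<partial>N) = (\<integral>\<omega>. (indicator A \<omega> / prob A) *\<^sub>R iexp (u * Z \<omega>) \<partial>M)"
      unfolding N_density using A Z by (intro integral_density) auto
    also have "\<dots> = (\<integral>\<omega>. of_bool (P \<omega>) * iexp (u * Z \<omega>) / of_real (prob A) \<partial>M)"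
      by (intro Bochner_Integration.integral_cong) (auto simp: A_def scaleR_conv_of_real)
    also have "\<dots> = (\<integral>\<omega>. of_bool (P \<omega>) * iexp (u * Z \<omega>) \<partial>M) / of_real (prob A)"
      by simp
    also have "\<dots> = (\<integral>z. of_real (g z) * iexp (u * z) \<partial>lborel)"
      unfolding char A_def[symmetric] using A(2) by simp
    finally show ?thesis .
  qed
  \<comment> \<open>The hypothesis at \<open>u = 0\<close> says that \<open>g\<close> has total mass \<open>1\<close>.\<close>
  have "complex_of_real (\<integral>z. g z \<partial>lborel) = 1"
    using char_N[of 0] N.prob_space by simp
  then have total: "(\<integral>z. g z \<partial>lborel) = 1" by (simp only: of_real_eq_1_iff)
  define D where "D = density lborel (\<lambda>z. ennreal (g z))"
  have "emeasure D (space D) = 1"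
    using g total by (simp add: D_def emeasure_density nn_integral_eq_integral)
  then interpret D: prob_space D by (rule prob_spaceI)
  have "real_distribution D"
    using D.prob_space_axioms by (simp add: real_distribution_def real_distribution_axioms_def) (simp add: D_def)
  moreover have "real_distribution (distr N borel Z)"
    using N.real_distribution_distr[OF ZN] .
  moreover have "char (distr N borel Z) = char D"
  proof
    fix u
    have "char (distr N borel Z) u = (\<integral>\<omega>. iexp (u * Z \<omega>) \<partial>N)"
      unfolding char_def by (subst integral_distr) auto
    also have "\<dots> = (\<integral>z. g z *\<^sub>R iexp (u * z) \<partial>lborel)"
      unfolding char_N by (simp add: scaleR_conv_of_real)
    also have "\<dots> = char D u"
      unfolding char_def D_def using g by (subst integral_density) auto
    finally show "char (distr N borel Z) u = char D u" .
  qed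
  ultimately have "distr N borel Z = D"
    by (intro Levy_uniqueness)
  moreover have "distr N lborel Z = distr N borel Z"
    by (rule distr_cong) auto
  ultimately show ?thesis
    using g(1) unfolding has_cond_density_def distributed_def A_def[symmetric] N_def[symmetric]
    by (auto simp: D_def)
qed

lemma integral_shift_iexp:
  "(\<integral>z. of_real (f (z - d)) * iexp (u * z) \<partial>lborel) =
     iexp (u * d) * (\<integral>w. of_real (f w) * iexp (u * w) \<partial>lborel)"
proof -
  have "(\<integral>z. of_real (f (z - d)) * iexp (u * z) \<partial>lborel) = (\<integral>w. of_real (f w) * iexp (u * (d + w)) \<partial>lborel)"
    by (subst lborel_integral_real_affine[where c = 1 and t = d]) auto
  also have "\<dots> = (\<integral>w. iexp (u * d) * (of_real (f w) * iexp (u * w)) \<partial>lborel)"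
    by (simp add: distrib_left exp_add mult_ac)
  finally show ?thesis by simp
qed

text \<open>A location mixture of normal densities: its Fourier transform is that of the mixing measure
  times that of the normal density, by Fubini's theorem.\<close>

lemma
  fixes r :: "real \<Rightarrow> real" and l :: "real \<Rightarrow> real"
  assumes s: "s > 0" and r: "integrable lborel r" and l[measurable]: "l \<in> borel_measurable borel"
  shows gaussian_mixture_integrable: "integrable lborel (\<lambda>z. \<integral>y. normal_density 0 s (z - l y) * r y \<partial>lborel)"
    and gaussian_mixture_char: "(\<integral>z. of_real (\<integral>y. normal_density 0 s (z - l y) * r y \<partial>lborel) * iexp (u * z) \<partial>lborel) =
      (\<integral>y. iexp (u * l y) * of_real (r y) \<partial>lborel) * (\<integral>w. of_real (normal_density 0 s w) * iexp (u * w) \<partial>lborel)"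
proof -
  have [measurable]: "r \<in> borel_measurable borel" using r by auto
  define f where "f u p = (case p of (y, z) \<Rightarrow> of_real (normal_density 0 s (z - l y) * r y) * iexp (u * z))" for u p
  have [measurable]: "f u \<in> borel_measurable (lborel \<Otimes>\<^sub>M lborel)" for u unfolding f_def by measurable
  have shift: "(\<integral>z. normal_density 0 s (z - d) \<partial>lborel) = 1" "integrable lborel (\<lambda>z. normal_density 0 s (z - d))" for d
    using lborel_integral_real_affine[of 1 "\<lambda>z. normal_density 0 s (z - d)" d]
      lborel_integrable_real_affine[of "normal_density 0 s" 1 "-d"] s
    by (simp_all add: integral_normal_density integrable_normal_density)
  have int_f: "integrable (lborel \<Otimes>\<^sub>M lborel) (f u)" for u
  proof (rule lborel_pair.Fubini_integrable)
    have "(\<integral>z. norm (f u (y, z)) \<partial>lborel) = \<bar>r y\<bar>" for y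
      using shift(1)[of "l y"] by (simp add: f_def norm_mult abs_mult)
    then show "integrable lborel (\<lambda>y. \<integral>z. norm (f u (y, z)) \<partial>lborel)"
      using r by simp
    show "AE y in lborel. integrable lborel (\<lambda>z. f u (y, z))"
    proof (rule AE_I2)
      fix y
      have "integrable lborel (\<lambda>z. normal_density 0 s (z - l y) * r y)"
        using shift(2)[of "l y"] by simp
      then show "integrable lborel (\<lambda>z. f u (y, z))"
        by (rule Bochner_Integration.integrable_bound) (auto simp: f_def norm_mult abs_mult)
    qed
  qed simp
  have inner: "(\<integral>y. f u (y, z) \<partial>lborel) = of_real (\<integral>y. normal_density 0 s (z - l y) * r y \<partial>lborel) * iexp (u * z)" for u z
    unfolding f_def prod.case by (simp only: integral_mult_left_zero integral_complex_of_real)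
  have "integrable lborel (\<lambda>z. \<integral>y. f 0 (y, z) \<partial>lborel)"
    using lborel_pair.integrable_snd[of "\<lambda>y z. f 0 (y, z)"] int_f[of 0] by simp
  then show "integrable lborel (\<lambda>z. \<integral>y. normal_density 0 s (z - l y) * r y \<partial>lborel)"
    unfolding inner by (simp add: complex_of_real_integrable_eq)
  have swap: "(\<integral>z. (\<integral>y. f u (y, z) \<partial>lborel) \<partial>lborel) = (\<integral>y. (\<integral>z. f u (y, z) \<partial>lborel) \<partial>lborel)"
    using lborel_pair.Fubini_integral[of "\<lambda>y z. f u (y, z)"] int_f[of u] by simp
  have "(\<integral>z. f u (y, z) \<partial>lborel) = iexp (u * l y) * of_real (r y) * (\<integral>w. of_real (normal_density 0 s w) * iexp (u * w) \<partial>lborel)" for y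
  proof -
    have "(\<integral>z. f u (y, z) \<partial>lborel) = (\<integral>z. of_real (r y) * (of_real (normal_density 0 s (z - l y)) * iexp (u * z)) \<partial>lborel)"
      by (simp add: f_def mult_ac)
    then show ?thesis
      by (simp only: integral_mult_right_zero integral_shift_iexp) (simp only: mult_ac)
  qed
  with swap show "(\<integral>z. of_real (\<integral>y. normal_density 0 s (z - l y) * r y \<partial>lborel) * iexp (u * z) \<partial>lborel) =
      (\<integral>y. iexp (u * l y) * of_real (r y) \<partial>lborel) * (\<integral>w. of_real (normal_density 0 s w) * iexp (u * w) \<partial>lborel)"
    unfolding inner by (simp only: integral_mult_left_zero)
qed

text \<open>The substitution \<open>x = a h + b y\<close>, which reverses the interval if \<open>b < 0\<close>.\<close>

lemma set_integral_affine_image: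
  fixes f :: "real \<Rightarrow> real"
  assumes "b \<noteq> 0"
  shows "1 / \<bar>b\<bar> * (LINT x:{h * (a - \<bar>b\<bar>)..h * (a + \<bar>b\<bar>)}|lborel. f x * q ((x - a * h) / b)) =
    (LINT y:{-h..h}|lborel. f (a * h + b * y) * q y)"
proof -
  have ind: "indicator {h * (a - \<bar>b\<bar>)..h * (a + \<bar>b\<bar>)} (a * h + b * y) = (indicator {-h..h} y :: real)" for y
  proof -
    have "a * h + b * y \<in> {h * (a - \<bar>b\<bar>)..h * (a + \<bar>b\<bar>)} \<longleftrightarrow> \<bar>b * y\<bar> \<le> \<bar>b\<bar> * h"
      by (auto simp: abs_le_iff algebra_simps)
    also have "\<dots> \<longleftrightarrow> \<bar>y\<bar> \<le> h" using assms by (simp add: abs_mult)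
    also have "\<dots> \<longleftrightarrow> y \<in> {-h..h}" by auto
    finally show ?thesis by (simp only: indicator_def of_bool_def)
  qed
  have "(LINT x:{h * (a - \<bar>b\<bar>)..h * (a + \<bar>b\<bar>)}|lborel. f x * q ((x - a * h) / b)) =
    \<bar>b\<bar> * (\<integral>y. indicator {h * (a - \<bar>b\<bar>)..h * (a + \<bar>b\<bar>)} (a * h + b * y) * (f (a * h + b * y) * q ((a * h + b * y - a * h) / b)) \<partial>lborel)"
    unfolding set_lebesgue_integral_def
    by (subst lborel_integral_real_affine[OF assms, where t = "a * h"]) simp
  then show ?thesis
    using assms unfolding ind by (simp add: set_lebesgue_integral_def)
qed

text \<open>Let the law of \<open>T\<close> given \<open>P\<close> be \<open>c\<close> times the sum of a point mass \<open>\<kappa>\<close> at \<open>h\<close> and the density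
  \<open>q\<close> on \<open>[-h, h]\<close>, expressed through characteristic functions. Adding independent normal noise
  to an affine image of \<open>T\<close> turns the point mass into a normal density and the rest into a
  mixture of normal densities. Independence is expressed by the product formula for
  characteristic functions.\<close>

lemma smoothed_cond_density:
  fixes q :: "real \<Rightarrow> real"
  assumes M: "prob_space M" and P: "{\<omega>\<in>space M. P \<omega>} \<in> sets M" "\<P>(\<omega> in M. P \<omega>) > 0"
    and T: "T \<in> borel_measurable M"
    and V: "distributed M lborel V (\<lambda>x. ennreal (normal_density 0 s x))" and s: "s > 0"
    and b: "b \<noteq> 0" and h: "h > 0" and "c \<ge> 0" "\<kappa> \<ge> 0"
    and q: "\<And>y. y \<in> {-h..h} \<Longrightarrow> 0 \<le> q y" "set_integrable lborel {-h..h} q"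
    and indep: "\<And>u. (\<integral>\<omega>. of_bool (P \<omega>) * iexp (u * (a * h + b * T \<omega>)) * iexp (u * V \<omega>) \<partial>M) =
       (\<integral>\<omega>. of_bool (P \<omega>) * iexp (u * (a * h + b * T \<omega>)) \<partial>M) * (\<integral>\<omega>. iexp (u * V \<omega>) \<partial>M)"
    and char: "\<And>v. (\<integral>\<omega>. of_bool (P \<omega>) * iexp (v * T \<omega>) \<partial>M) = of_real (\<P>(\<omega> in M. P \<omega>) * c) *
       (of_real \<kappa> * iexp (v * h) + (LINT y:{-h..h}|lborel. iexp (v * y) * of_real (q y)))"
    and Z: "\<And>\<omega>. \<omega> \<in> space M \<Longrightarrow> Z \<omega> = a * h + b * T \<omega> + V \<omega>"
  shows "has_cond_density M P Z (\<lambda>z. c * (\<kappa> * normal_density 0 s (z - h * (b + a)) +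
     1 / \<bar>b\<bar> * (LINT x:{h * (a - \<bar>b\<bar>)..h * (a + \<bar>b\<bar>)}|lborel. normal_density 0 s (z - x) * q ((x - a * h) / b))))"
proof -
  interpret prob_space M by fact
  let ?\<phi> = "normal_density 0 s"
  define r where "r y = indicator {-h..h} y * q y" for y
  have r: "integrable lborel r" "\<And>y. 0 \<le> r y"
    using q by (auto simp: r_def[abs_def] set_integrable_def indicator_def)
  define l where "l y = a * h + b * y" for y
  have l: "l \<in> borel_measurable borel" unfolding l_def by simp
  define J where "J z = (\<integral>y. ?\<phi> (z - l y) * r y \<partial>lborel)" for z
  define \<gamma> where "\<gamma> u = (\<integral>w. of_real (?\<phi> w) * iexp (u * w) \<partial>lborel)" for u
  have J: "integrable lborel J" "\<And>z. 0 \<le> J z"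
    and char_J: "(\<integral>z. of_real (J z) * iexp (u * z) \<partial>lborel) = (\<integral>y. iexp (u * l y) * of_real (r y) \<partial>lborel) * \<gamma> u" for u
    using gaussian_mixture_integrable[OF s r(1) l] gaussian_mixture_char[OF s r(1) l] r(2)
    by (auto simp: J_def[abs_def] \<gamma>_def intro!: Bochner_Integration.integral_nonneg)
  have \<phi>: "integrable lborel (\<lambda>z. ?\<phi> (z - d))" for d
    using lborel_integrable_real_affine[of ?\<phi> 1 "-d"] s by simp
  have J_eq: "J z = 1 / \<bar>b\<bar> * (LINT x:{h * (a - \<bar>b\<bar>)..h * (a + \<bar>b\<bar>)}|lborel. ?\<phi> (z - x) * q ((x - a * h) / b))" for z
    by (subst set_integral_affine_image[OF b, of h a "\<lambda>x. ?\<phi> (z - x)"])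
      (simp add: J_def r_def l_def set_lebesgue_integral_def mult_ac)
  define g where "g z = c * (\<kappa> * ?\<phi> (z - h * (b + a)) + J z)" for z
  have g: "0 \<le> g z" "integrable lborel g" for z
    unfolding g_def[abs_def] using J \<phi>[of "h * (b + a)"] \<open>c \<ge> 0\<close> \<open>\<kappa> \<ge> 0\<close> by auto
  have [measurable]: "V \<in> borel_measurable M" using V by (simp add: distributed_def)
  note T[measurable]
  have Z_meas: "Z \<in> borel_measurable M"
    by (subst measurable_cong[OF Z]) auto
  have char_V: "(\<integral>\<omega>. iexp (u * V \<omega>) \<partial>M) = \<gamma> u" for u
  proof -
    have "(\<integral>\<omega>. iexp (u * V \<omega>) \<partial>M) = (\<integral>w. iexp (u * w) \<partial>distr M lborel V)"
      by (subst integral_distr) auto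
    also have "\<dots> = (\<integral>w. ?\<phi> w *\<^sub>R iexp (u * w) \<partial>lborel)"
      unfolding distributed_distr_eq_density[OF V] by (subst integral_density) auto
    finally show ?thesis by (simp add: \<gamma>_def scaleR_conv_of_real)
  qed
  have "has_cond_density M P Z g"
  proof (rule has_cond_density_charI[OF M Z_meas P g])
    fix u
    have "(\<integral>\<omega>. of_bool (P \<omega>) * iexp (u * Z \<omega>) \<partial>M) = (\<integral>\<omega>. of_bool (P \<omega>) * iexp (u * (a * h + b * T \<omega>)) * iexp (u * V \<omega>) \<partial>M)"
      by (intro Bochner_Integration.integral_cong) (auto simp: Z exp_add[symmetric] algebra_simps)
    also have "\<dots> = (\<integral>\<omega>. of_bool (P \<omega>) * iexp (u * (a * h + b * T \<omega>)) \<partial>M) * \<gamma> u"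
      unfolding indep char_V ..
    also have "(\<integral>\<omega>. of_bool (P \<omega>) * iexp (u * (a * h + b * T \<omega>)) \<partial>M) =
      (\<integral>\<omega>. iexp (u * (a * h)) * (of_bool (P \<omega>) * iexp ((u * b) * T \<omega>)) \<partial>M)"
      by (simp add: distrib_left exp_add mult_ac)
    also have "\<dots> = of_real (\<P>(\<omega> in M. P \<omega>) * c) * (iexp (u * (a * h)) *
       (of_real \<kappa> * iexp (u * b * h) + (LINT y:{-h..h}|lborel. iexp (u * b * y) * of_real (q y))))"
      by (simp only: integral_mult_right_zero char) (simp only: mult_ac)
    also have "iexp (u * (a * h)) * (of_real \<kappa> * iexp (u * b * h) + (LINT y:{-h..h}|lborel. iexp (u * b * y) * of_real (q y)))
      = of_real \<kappa> * iexp (u * (h * (b + a))) + (\<integral>y. iexp (u * l y) * of_real (r y) \<partial>lborel)"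
    proof -
      have "(\<integral>y. iexp (u * l y) * of_real (r y) \<partial>lborel) = (\<integral>y. iexp (u * (a * h)) * (indicator {-h..h} y *\<^sub>R (iexp (u * b * y) * of_real (q y))) \<partial>lborel)"
        by (intro Bochner_Integration.integral_cong refl)
          (simp add: r_def l_def distrib_left exp_add scaleR_conv_of_real mult_ac)
      then have *: "(\<integral>y. iexp (u * l y) * of_real (r y) \<partial>lborel) = iexp (u * (a * h)) * (LINT y:{-h..h}|lborel. iexp (u * b * y) * of_real (q y))"
        by (simp only: integral_mult_right_zero set_lebesgue_integral_def)
      have "iexp (u * (h * (b + a))) = iexp (u * (a * h)) * iexp (u * b * h)"
        by (simp add: exp_add[symmetric] algebra_simps)
      then show ?thesis unfolding * by (simp add: algebra_simps)
    qed
    also have "of_real (\<P>(\<omega> in M. P \<omega>) * c) * \<dots> * \<gamma> u = of_real (\<P>(\<omega> in M. P \<omega>)) * (\<integral>z. of_real (g z) * iexp (u * z) \<partial>lborel)"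
    proof -
      have bound: "integrable lborel (\<lambda>z. of_real (f z) * iexp (u * z))" if "integrable lborel f" for f :: "real \<Rightarrow> real"
        by (rule Bochner_Integration.integrable_bound[OF that]) (use that in \<open>auto simp: norm_mult\<close>)
      have "(\<integral>z. of_real (g z) * iexp (u * z) \<partial>lborel) =
        (\<integral>z. of_real c * (of_real \<kappa> * (of_real (?\<phi> (z - h * (b + a))) * iexp (u * z)) + of_real (J z) * iexp (u * z)) \<partial>lborel)"
        by (simp add: g_def algebra_simps)
      also have "\<dots> = of_real c * (of_real \<kappa> * (iexp (u * (h * (b + a))) * \<gamma> u) + (\<integral>y. iexp (u * l y) * of_real (r y) \<partial>lborel) * \<gamma> u)"
        unfolding integral_mult_right_zero
        by (subst Bochner_Integration.integral_add)
          (auto intro!: bound J \<phi> simp only: integral_mult_right_zero integral_shift_iexp char_J \<gamma>_def[symmetric] intro: integrable_mult_right)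
      finally show ?thesis by (simp add: algebra_simps)
    qed
    finally show "(\<integral>\<omega>. of_bool (P \<omega>) * iexp (u * Z \<omega>) \<partial>M) =
      of_real (\<P>(\<omega> in M. P \<omega>)) * (\<integral>z. of_real (g z) * iexp (u * z) \<partial>lborel)" .
  qed
  then show ?thesis unfolding g_def[abs_def] J_eq .
qed

section \<open>The noise and the chain\<close>

text \<open>The \<sigma>-algebras generated by \<open>F\<close> and \<open>G\<close> lie in those generated by the two processes, so \<open>F\<close>
  and \<open>G\<close> are independent random variables.\<close>

lemma independent_processes_expectation:
  fixes F G :: "'a \<Rightarrow> complex"
  assumes M: "prob_space M" and indep: "independent_processes M X W"
    and F: "F \<in> borel_measurable (vimage_algebra (space M) (\<lambda>\<omega>. restrict (\<lambda>t. X t \<omega>) {0..}) (PiM {0..} (\<lambda>_. count_space UNIV)))"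
    and G: "G \<in> borel_measurable (vimage_algebra (space M) (\<lambda>\<omega>. restrict (\<lambda>t. W t \<omega>) {0..}) (PiM {0..} (\<lambda>_. borel)))"
    and bounded: "\<And>\<omega>. norm (F \<omega>) \<le> 1" "\<And>\<omega>. norm (G \<omega>) \<le> 1"
  shows "(\<integral>\<omega>. F \<omega> * G \<omega> \<partial>M) = (\<integral>\<omega>. F \<omega> \<partial>M) * (\<integral>\<omega>. G \<omega> \<partial>M)"
proof -
  interpret prob_space M by fact
  let ?A = "vimage_algebra (space M) (\<lambda>\<omega>. restrict (\<lambda>t. X t \<omega>) {0..}) (PiM {0..} (\<lambda>_. count_space UNIV))"
  let ?B = "vimage_algebra (space M) (\<lambda>\<omega>. restrict (\<lambda>t. W t \<omega>) {0..}) (PiM {0..} (\<lambda>_. borel))"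
  have AB: "indep_set (sets ?A) (sets ?B)"
    using indep by (simp add: independent_processes_def)
  have sub: "sets ?A \<subseteq> sets M" "sets ?B \<subseteq> sets M"
    using indep_setD_ev1[OF AB] indep_setD_ev2[OF AB] by auto
  have gen: "sigma_sets (space M) {H -` S \<inter> space M |S. S \<in> sets borel} \<subseteq> sets N"
    if "H \<in> borel_measurable N" "space N = space M" for H :: "'a \<Rightarrow> complex" and N
    using that measurable_sets[OF that(1)] sets.top[of N] by (intro sets.sigma_sets_subset'[of _ N, unfolded that(2)]) auto
  have meas: "F \<in> borel_measurable M" "G \<in> borel_measurable M"
    using F G sub by (auto simp: measurable_def)
  have "indep_var borel F borel G"
    unfolding indep_var_eq
  proof (intro conjI meas indep_setI)
    let ?F = "sigma_sets (space M) {F -` A \<inter> space M |A. A \<in> sets borel}"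
    let ?G = "sigma_sets (space M) {G -` A \<inter> space M |A. A \<in> sets borel}"
    have subs: "?F \<subseteq> sets ?A" "?G \<subseteq> sets ?B" using gen[OF F] gen[OF G] by auto
    then show "?F \<subseteq> events" "?G \<subseteq> events" using sub by auto
    show "prob (a \<inter> b) = prob a * prob b" if "a \<in> ?F" "b \<in> ?G" for a b
      using that subs by (intro indep_setD[OF AB]) auto
  qed
  then show ?thesis
    using meas bounded by (intro indep_var_lebesgue_integral integrable_const_bound[where B = 1]) auto
qed

lemma brownian_motion_marginal:
  assumes "prob_space M" and W: "brownian_motion M W" and "t > 0"
  shows "distributed M lborel (W t) (\<lambda>x. ennreal (normal_density 0 (sqrt t) x))"
proof -
  have meas: "W t \<in> borel_measurable M" "W 0 \<in> borel_measurable M"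
    and AE: "AE \<omega> in M. W 0 \<omega> = 0"
    and D: "distributed M lborel (\<lambda>\<omega>. W t \<omega> - W 0 \<omega>) (\<lambda>x. ennreal (normal_density 0 (sqrt t) x))"
    using W \<open>t > 0\<close> unfolding brownian_motion_def by (auto dest: spec[of _ 0])
  have "distr M lborel (W t) = distr M lborel (\<lambda>\<omega>. W t \<omega> - W 0 \<omega>)"
    using AE meas by (intro distr_cong_AE) auto
  with D meas show ?thesis by (simp add: distributed_def)
qed

section \<open>Densities of the chain integral with Brownian noise\<close>

theorem theorem3p1:
  fixes M :: "'a measure"
    and \<epsilon> :: "real \<Rightarrow> 'a \<Rightarrow> 2"
    and W :: "real \<Rightarrow> 'a \<Rightarrow> real"
    and Z :: "'a \<Rightarrow> real"
    and lam \<sigma> h a :: real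
    and \<alpha> b :: "2 \<Rightarrow> real"
  assumes "prob_space M"
    and "lam > 0" and "\<sigma> > 0" and "h > 0" and "\<alpha> 1 \<noteq> \<alpha> 2"
    and "markov_chain M (vector [vector [-lam, lam], vector [lam, -lam]] :: real^2^2) \<epsilon>"
    and "brownian_motion M W"
    and "independent_processes M \<epsilon> W"
    and "Z = (\<lambda>\<omega>. (LINT s:{0..h}|lborel. \<alpha> (\<epsilon> s \<omega>)) + \<sigma> * W h \<omega>)"
    and "a = (\<alpha> 1 + \<alpha> 2) / 2"
    and "b 1 = (\<alpha> 1 - \<alpha> 2) / 2"
    and "b 2 = (\<alpha> 2 - \<alpha> 1) / 2"
  shows
    "(\<forall>i. \<P>(\<omega> in M. \<epsilon> 0 \<omega> = i) > 0 \<longrightarrow>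
        has_cond_density M (\<lambda>\<omega>. \<epsilon> 0 \<omega> = i) Z (\<lambda>z. exp (- lam * h) *
          (normal_density 0 (\<sigma> * sqrt h) (z - h * (b i + a)) +
           1 / \<bar>b i\<bar> * (LINT x:{h * (a - \<bar>b i\<bar>)..h * (a + \<bar>b i\<bar>)}|lborel.
             normal_density 0 (\<sigma> * sqrt h) (z - x) * q_tilde h lam ((x - a * h) / b i)))))
     \<and>
     (\<forall>i. \<P>(\<omega> in M. \<epsilon> 0 \<omega> = i) > 0 \<longrightarrow>
        has_cond_density M (\<lambda>\<omega>. \<epsilon> 0 \<omega> = i \<and> \<epsilon> h \<omega> = i) Z (\<lambda>z. 1 / cosh (lam * h) *
          (normal_density 0 (\<sigma> * sqrt h) (z - h * (b i + a)) +
           1 / \<bar>b i\<bar> * (LINT x:{h * (a - \<bar>b i\<bar>)..h * (a + \<bar>b i\<bar>)}|lborel.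
             normal_density 0 (\<sigma> * sqrt h) (z - x) * q_tilde_plus h lam ((x - a * h) / b i)))))
     \<and>
     (\<forall>i j. i \<noteq> j \<longrightarrow> \<P>(\<omega> in M. \<epsilon> 0 \<omega> = i) > 0 \<longrightarrow>
        has_cond_density M (\<lambda>\<omega>. \<epsilon> 0 \<omega> = i \<and> \<epsilon> h \<omega> = j) Z (\<lambda>z. 1 / (sinh (lam * h) * \<bar>b i\<bar>) *
          (LINT x:{h * (a - \<bar>b i\<bar>)..h * (a + \<bar>b i\<bar>)}|lborel.
             normal_density 0 (\<sigma> * sqrt h) (z - x) * q_tilde_minus h lam ((x - a * h) / b i))))"
proof -
  note M = assms(1) and lam = assms(2) and sigma = assms(3) and h = assms(4) and chain = assms(6)
  interpret prob_space M by (rule M)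
  define s where "s = \<sigma> * sqrt h"
  have s: "s > 0" using sigma h by (simp add: s_def)
  have V: "distributed M lborel (\<lambda>\<omega>. \<sigma> * W h \<omega>) (\<lambda>x. ennreal (normal_density 0 s x))"
    using normal_density_affine[OF brownian_motion_marginal[OF M assms(7) h], of \<sigma> 0] sigma h
    by (simp add: s_def)
  have b: "b i \<noteq> 0" for i
    using exhaust_2[of i] assms(5,11,12) by auto
  have rc: "\<forall>\<^sub>F s in at_right t. \<epsilon> s \<omega> = \<epsilon> t \<omega>" if "\<omega> \<in> space M" "t \<ge> 0" for \<omega> t
    using chain that by (auto simp: markov_chain_def)
  define T where "T i \<omega> = (LINT s:{0..h}|lborel. telegraph_sign i (\<epsilon> s \<omega>))" for i \<omega>
  have Z: "Z \<omega> = a * h + b i * T i \<omega> + \<sigma> * W h \<omega>" if "\<omega> \<in> space M" for i \<omega>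
  proof -
    have "\<alpha> x = a + b i * telegraph_sign i x" for x
      using exhaust_2[of i] exhaust_2[of x] assms(10-12) by (auto simp: field_simps)
    then show ?thesis
      unfolding assms(9) T_def using rc[OF that] by (subst time_integral_affine[OF h]) auto
  qed
  let ?A = "vimage_algebra (space M) (\<lambda>\<omega>. restrict (\<lambda>t. \<epsilon> t \<omega>) {0..}) (PiM {0..} (\<lambda>_. count_space UNIV))"
  let ?B = "vimage_algebra (space M) (\<lambda>\<omega>. restrict (\<lambda>t. W t \<omega>) {0..}) (PiM {0..} (\<lambda>_. borel))"
  have X_A: "\<epsilon> t \<in> measurable ?A (count_space UNIV)" if "t \<ge> 0" for t
  proof -
    have "(\<lambda>\<omega>. restrict (\<lambda>t. \<epsilon> t \<omega>) {0..} t) \<in> measurable ?A (count_space UNIV)"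
      using that by (intro measurable_compose[OF measurable_vimage_algebra1 measurable_component_singleton])
        (auto simp: space_PiM PiE_def extensional_def)
    then show ?thesis using that by simp
  qed
  have W_B: "W h \<in> borel_measurable ?B"
  proof -
    have "(\<lambda>\<omega>. restrict (\<lambda>t. W t \<omega>) {0..} h) \<in> measurable ?B borel"
      using h by (intro measurable_compose[OF measurable_vimage_algebra1 measurable_component_singleton])
        (auto simp: space_PiM PiE_def extensional_def)
    then show ?thesis using h by simp
  qed
  have T_A: "T i \<in> borel_measurable ?A" for i
    unfolding T_def[abs_def] using rc by (intro time_integral_measurable[OF h X_A]) (auto simp: space_vimage_algebra)
  have X_M: "\<epsilon> t \<in> measurable M (count_space UNIV)" if "t \<ge> 0" for t
    using chain that by (auto simp: markov_chain_def)
  have T_M: "T i \<in> borel_measurable M" for i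
    unfolding T_def[abs_def] using rc by (intro time_integral_measurable[OF h X_M]) auto
  \<comment> \<open>It remains to know the characteristic function of \<open>T i\<close> on the conditioning event.\<close>
  have density: "has_cond_density M (\<lambda>\<omega>. P (\<epsilon> 0 \<omega>) (\<epsilon> h \<omega>)) Z (\<lambda>z. c * (\<kappa> * normal_density 0 s (z - h * (b i + a)) +
     1 / \<bar>b i\<bar> * (LINT x:{h * (a - \<bar>b i\<bar>)..h * (a + \<bar>b i\<bar>)}|lborel. normal_density 0 s (z - x) * q ((x - a * h) / b i))))"
    if "\<P>(\<omega> in M. P (\<epsilon> 0 \<omega>) (\<epsilon> h \<omega>)) > 0" "c \<ge> 0" "\<kappa> \<ge> 0"
      and "\<And>y. y \<in> {-h..h} \<Longrightarrow> 0 \<le> q y" "set_integrable lborel {-h..h} q"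
      and "\<And>v. (\<integral>\<omega>. of_bool (P (\<epsilon> 0 \<omega>) (\<epsilon> h \<omega>)) * iexp (v * T i \<omega>) \<partial>M) = of_real (\<P>(\<omega> in M. P (\<epsilon> 0 \<omega>) (\<epsilon> h \<omega>)) * c) *
       (of_real \<kappa> * iexp (v * h) + (LINT y:{-h..h}|lborel. iexp (v * y) * of_real (q y)))"
    for P c \<kappa> q i
  proof (rule smoothed_cond_density[where T = "T i" and V = "\<lambda>\<omega>. \<sigma> * W h \<omega>", OF M _ that(1) T_M V s b h that(2,3,4,5) _ that(6) Z])
    show "{\<omega> \<in> space M. P (\<epsilon> 0 \<omega>) (\<epsilon> h \<omega>)} \<in> sets M"
    proof -
      have [measurable]: "\<epsilon> 0 \<in> measurable M (count_space UNIV)" "\<epsilon> h \<in> measurable M (count_space UNIV)"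
        using X_M h by auto
      show ?thesis by measurable
    qed
    show "(\<integral>\<omega>. of_bool (P (\<epsilon> 0 \<omega>) (\<epsilon> h \<omega>)) * iexp (u * (a * h + b i * T i \<omega>)) * iexp (u * (\<sigma> * W h \<omega>)) \<partial>M) =
       (\<integral>\<omega>. of_bool (P (\<epsilon> 0 \<omega>) (\<epsilon> h \<omega>)) * iexp (u * (a * h + b i * T i \<omega>)) \<partial>M) * (\<integral>\<omega>. iexp (u * (\<sigma> * W h \<omega>)) \<partial>M)" for u
    proof (rule independent_processes_expectation[OF M assms(8)])
      note [measurable] = T_A[of i] W_B
      have [measurable]: "\<epsilon> 0 \<in> measurable ?A (count_space UNIV)" "\<epsilon> h \<in> measurable ?A (count_space UNIV)"
        using X_A h by auto
      show "(\<lambda>\<omega>. of_bool (P (\<epsilon> 0 \<omega>) (\<epsilon> h \<omega>)) * iexp (u * (a * h + b i * T i \<omega>))) \<in> borel_measurable ?A"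
        by measurable
      show "(\<lambda>\<omega>. iexp (u * (\<sigma> * W h \<omega>))) \<in> borel_measurable ?B"
        by measurable
    qed (auto simp: norm_mult)
  qed
  have char: "(\<integral>\<omega>. of_bool (\<epsilon> 0 \<omega> = i \<and> \<epsilon> h \<omega> = j) * iexp (v * T i \<omega>) \<partial>M)
    = of_real (\<P>(\<omega> in M. \<epsilon> 0 \<omega> = i)) * (of_real (exp (- (lam * h))) *
       (if i = j then telegraph_diag v lam h else telegraph_off v lam h))" for i j v
    unfolding T_def by (rule telegraph_char_from_start[OF M lam h chain])
  note prob2 = telegraph_two_time_prob[OF chain less_imp_le[OF h]]
  have hyp: "0 < cosh (lam * h)" "0 < sinh (lam * h)"
    using lam h by (simp_all add: cosh_real_pos)
  show ?thesis
  proof (intro conjI allI impI)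
    fix i assume pos: "\<P>(\<omega> in M. \<epsilon> 0 \<omega> = i) > 0"
    have "has_cond_density M (\<lambda>\<omega>. \<epsilon> 0 \<omega> = i) Z (\<lambda>z. exp (- lam * h) * (1 * normal_density 0 s (z - h * (b i + a)) +
     1 / \<bar>b i\<bar> * (LINT x:{h * (a - \<bar>b i\<bar>)..h * (a + \<bar>b i\<bar>)}|lborel. normal_density 0 s (z - x) * q_tilde h lam ((x - a * h) / b i))))"
    proof (rule density[of "\<lambda>x y. x = i"])
      show "0 \<le> q_tilde h lam y" if "y \<in> {-h..h}" for y
        using q_tilde_nonneg[OF lam that] by (simp add: q_tilde_eq)
      show "set_integrable lborel {-h..h} (q_tilde h lam)"
        unfolding q_tilde_eq[abs_def]
        using telegraph_off_eq_fourier(2)[OF h] telegraph_diag_eq_fourier(2)[OF h] by (intro set_integral_add)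
      fix v
      \<comment> \<open>Without a condition on \<open>\<epsilon> h\<close>, add the contributions of the two end states.\<close>
      define j :: 2 where "j = (if i = 1 then 2 else 1)"
      have ij: "i \<noteq> j" using exhaust_2[of i] by (auto simp: j_def)
      have split: "of_bool (\<epsilon> 0 \<omega> = i) = (of_bool (\<epsilon> 0 \<omega> = i \<and> \<epsilon> h \<omega> = i) + of_bool (\<epsilon> 0 \<omega> = i \<and> \<epsilon> h \<omega> = j) :: complex)" for \<omega>
        using exhaust_2[of i] exhaust_2[of "\<epsilon> h \<omega>"] by (auto simp: j_def)
      have int: "integrable M (\<lambda>\<omega>. of_bool (\<epsilon> 0 \<omega> = i \<and> \<epsilon> h \<omega> = k) * iexp (v * T i \<omega>))" for k
      proof (rule integrable_const_bound[where B = 1])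
        have [measurable]: "\<epsilon> 0 \<in> measurable M (count_space UNIV)" "\<epsilon> h \<in> measurable M (count_space UNIV)" "T i \<in> borel_measurable M"
          using X_M h T_M by auto
        show "(\<lambda>\<omega>. of_bool (\<epsilon> 0 \<omega> = i \<and> \<epsilon> h \<omega> = k) * iexp (v * T i \<omega>)) \<in> borel_measurable M"
          by measurable
      qed (auto simp: norm_mult)
      have "(\<integral>\<omega>. of_bool (\<epsilon> 0 \<omega> = i) * iexp (v * T i \<omega>) \<partial>M) =
        of_real (\<P>(\<omega> in M. \<epsilon> 0 \<omega> = i)) * (of_real (exp (- (lam * h))) * (telegraph_diag v lam h + telegraph_off v lam h))"
        unfolding split distrib_right by (subst Bochner_Integration.integral_add[OF int int])
          (simp only: char if_P[OF refl] if_not_P[OF ij] distrib_left)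
      also have "telegraph_diag v lam h + telegraph_off v lam h =
        iexp (v * h) + (LINT y:{-h..h}|lborel. iexp (v * y) * of_real (q_tilde h lam y))"
      proof -
        have int_q: "set_integrable lborel {-h..h} (\<lambda>y. iexp (v * y) * of_real (q y))"
          if "set_integrable lborel {-h..h} q" "q \<in> borel_measurable borel" for q :: "real \<Rightarrow> real"
          using that(1) unfolding set_integrable_def
          by (rule Bochner_Integration.integrable_bound) (use that(2) in \<open>auto simp: norm_mult\<close>)
        show ?thesis
          unfolding telegraph_off_eq_fourier(1)[OF h] telegraph_diag_eq_fourier(1)[OF h] q_tilde_eq of_real_add distrib_left
          by (subst set_integral_add(2)[OF int_q[OF telegraph_diag_eq_fourier(2)[OF h] q_tilde_measurable(1)]
              int_q[OF telegraph_off_eq_fourier(2)[OF h] q_tilde_measurable(2)]]) (simp only: add.assoc)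
      qed
      finally show "(\<integral>\<omega>. of_bool (\<epsilon> 0 \<omega> = i) * iexp (v * T i \<omega>) \<partial>M) =
        of_real (\<P>(\<omega> in M. \<epsilon> 0 \<omega> = i) * exp (- lam * h)) *
          (of_real 1 * iexp (v * h) + (LINT y:{-h..h}|lborel. iexp (v * y) * of_real (q_tilde h lam y)))"
        by (simp add: mult.assoc)
    qed (use pos in auto)
    then show "has_cond_density M (\<lambda>\<omega>. \<epsilon> 0 \<omega> = i) Z (\<lambda>z. exp (- lam * h) *
          (normal_density 0 (\<sigma> * sqrt h) (z - h * (b i + a)) +
           1 / \<bar>b i\<bar> * (LINT x:{h * (a - \<bar>b i\<bar>)..h * (a + \<bar>b i\<bar>)}|lborel.
             normal_density 0 (\<sigma> * sqrt h) (z - x) * q_tilde h lam ((x - a * h) / b i))))"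
      unfolding s_def mult_1 .
  next
    fix i assume pos: "\<P>(\<omega> in M. \<epsilon> 0 \<omega> = i) > 0"
    have "has_cond_density M (\<lambda>\<omega>. \<epsilon> 0 \<omega> = i \<and> \<epsilon> h \<omega> = i) Z (\<lambda>z. 1 / cosh (lam * h) * (1 * normal_density 0 s (z - h * (b i + a)) +
     1 / \<bar>b i\<bar> * (LINT x:{h * (a - \<bar>b i\<bar>)..h * (a + \<bar>b i\<bar>)}|lborel. normal_density 0 s (z - x) * q_tilde_plus h lam ((x - a * h) / b i))))"
    proof (rule density[of "\<lambda>x y. x = i \<and> y = i"])
      show "0 < \<P>(\<omega> in M. \<epsilon> 0 \<omega> = i \<and> \<epsilon> h \<omega> = i)"
        unfolding prob2[OF pos] using pos hyp by simp
      show "(\<integral>\<omega>. of_bool (\<epsilon> 0 \<omega> = i \<and> \<epsilon> h \<omega> = i) * iexp (v * T i \<omega>) \<partial>M) =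
        of_real (\<P>(\<omega> in M. \<epsilon> 0 \<omega> = i \<and> \<epsilon> h \<omega> = i) * (1 / cosh (lam * h))) *
          (of_real 1 * iexp (v * h) + (LINT y:{-h..h}|lborel. iexp (v * y) * of_real (q_tilde_plus h lam y)))" for v
        unfolding prob2[OF pos] char telegraph_diag_eq_fourier(1)[OF h] using hyp by simp
    qed (use telegraph_diag_eq_fourier(2)[OF h] q_tilde_nonneg[OF lam] hyp in auto)
    then show "has_cond_density M (\<lambda>\<omega>. \<epsilon> 0 \<omega> = i \<and> \<epsilon> h \<omega> = i) Z (\<lambda>z. 1 / cosh (lam * h) *
          (normal_density 0 (\<sigma> * sqrt h) (z - h * (b i + a)) +
           1 / \<bar>b i\<bar> * (LINT x:{h * (a - \<bar>b i\<bar>)..h * (a + \<bar>b i\<bar>)}|lborel.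
             normal_density 0 (\<sigma> * sqrt h) (z - x) * q_tilde_plus h lam ((x - a * h) / b i))))"
      unfolding s_def mult_1 .
  next
    fix i j :: 2 assume ij: "i \<noteq> j" and pos: "\<P>(\<omega> in M. \<epsilon> 0 \<omega> = i) > 0"
    have "has_cond_density M (\<lambda>\<omega>. \<epsilon> 0 \<omega> = i \<and> \<epsilon> h \<omega> = j) Z (\<lambda>z. 1 / sinh (lam * h) * (0 * normal_density 0 s (z - h * (b i + a)) +
     1 / \<bar>b i\<bar> * (LINT x:{h * (a - \<bar>b i\<bar>)..h * (a + \<bar>b i\<bar>)}|lborel. normal_density 0 s (z - x) * q_tilde_minus h lam ((x - a * h) / b i))))"
    proof (rule density[of "\<lambda>x y. x = i \<and> y = j"])
      show "0 < \<P>(\<omega> in M. \<epsilon> 0 \<omega> = i \<and> \<epsilon> h \<omega> = j)"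
        unfolding prob2[OF pos] using pos hyp ij by simp
      show "(\<integral>\<omega>. of_bool (\<epsilon> 0 \<omega> = i \<and> \<epsilon> h \<omega> = j) * iexp (v * T i \<omega>) \<partial>M) =
        of_real (\<P>(\<omega> in M. \<epsilon> 0 \<omega> = i \<and> \<epsilon> h \<omega> = j) * (1 / sinh (lam * h))) *
          (of_real 0 * iexp (v * h) + (LINT y:{-h..h}|lborel. iexp (v * y) * of_real (q_tilde_minus h lam y)))" for v
        unfolding prob2[OF pos] char telegraph_off_eq_fourier(1)[OF h] using hyp ij lam h by simp
    qed (use telegraph_off_eq_fourier(2)[OF h] q_tilde_nonneg[OF lam] hyp in auto)
    then show "has_cond_density M (\<lambda>\<omega>. \<epsilon> 0 \<omega> = i \<and> \<epsilon> h \<omega> = j) Z (\<lambda>z. 1 / (sinh (lam * h) * \<bar>b i\<bar>) *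
          (LINT x:{h * (a - \<bar>b i\<bar>)..h * (a + \<bar>b i\<bar>)}|lborel.
             normal_density 0 (\<sigma> * sqrt h) (z - x) * q_tilde_minus h lam ((x - a * h) / b i)))"
      by (simp add: s_def)
  qed
qed

end
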